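(* Let $\mathbb{K}\in\{\mathbb{R},\mathbb{C}\}$ and let $\mathcal{A}=(A_1,\ldots,A_d)$ be positive semidefinite matrices in $\mathbb{K}^{n\times n}$ (symmetric if $\mathbb{K}=\mathbb{R}$, Hermitian if $\mathbb{K}=\mathbb{C}$). Suppose the semidefinite program defining $\mathrm{OptSDP}(\mathcal{A})$ has an optimal solution $X^*$ with $\operatorname{rank}(X^* )=r$. Then $$e^{-L_r(\mathbb{K})}\,\mathrm{OptSDP}(\mathcal{A})\le \mathrm{Opt}(\mathcal{A})\le \mathrm{OptSDP}(\mathcal{A}).$$ Moreover $L_r(\mathbb{R})<1.271$ and $L_r(\mathbb{C})<0.578$ for every positive integer $r$.
   Context: For $x,y\in\mathbb{K}^n$, $\langle x,y\rangle=x^\dagger y$ where $\dagger$ denotes transpose ($\mathbb{K}=\mathbb{R}$) or conjugate transpose ($\mathbb{K}=\mathbb{C}$), and $\|x\|^2=\langle x,x\rangle$; for matrices $\langle A,X\rangle=\operatorname{Tr}(A^\dagger X)$. Define $\mathrm{Opt}(\mathcal{A})=\max_{x\in\mathbb{K}^n,\ \|x\|=1}\big(\prod_{i=1}^d\langle x,A_ix\rangle\big)^{1/d}$ and $\mathrm{OptSDP}(\mathcal{A})=\max\big\{\big(\prod_{i=1}^d\langle A_i,X\rangle\big)^{1/d}: X\in\mathbb{K}^{n\times n}\text{ symmetric/Hermitian},\ X\succeq 0,\ \operatorname{Tr}X=1\big\}$. For a positive integer $r$, $L_r(\mathbb{R})=\gamma+\log 2+\psi(r/2)-\log(r/2)$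 and $L_r(\mathbb{C})=\gamma+\psi(r)-\log r$, where $\gamma$ is the Euler–Mascheroni constant and $\psi=\frac{d}{dx}\log\Gamma$ is the digamma function. *)

theory Defs
  imports "HOL-Analysis.Analysis"
begin

definition L_R :: "nat \<Rightarrow> real" where
  "L_R r = euler_mascheroni + ln 2 + Digamma (real r / 2) - ln (real r / 2)"

definition L_C :: "nat \<Rightarrow> real" where
  "L_C r = euler_mascheroni + Digamma (real r) - ln (real r)"

definition psd_R :: "real^'n^'n \<Rightarrow> bool" where
  "psd_R A \<longleftrightarrow> transpose A = A \<and> (\<forall>x. x \<bullet> (A *v x) \<ge> 0)"

definition Opt_R :: "(nat \<Rightarrow> real^'n^'n) \<Rightarrow> nat \<Rightarrow> real" where
  "Opt_R A d = Sup {root d (\<Prod>i<d. x \<bullet> (A i *v x)) | x. x \<bullet> x = 1}"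

definition sdp_feasible_R :: "real^'n^'n \<Rightarrow> bool" where
  "sdp_feasible_R X \<longleftrightarrow> psd_R X \<and> trace X = 1"

definition sdp_obj_R :: "(nat \<Rightarrow> real^'n^'n) \<Rightarrow> nat \<Rightarrow> real^'n^'n \<Rightarrow> real" where
  "sdp_obj_R A d X = root d (\<Prod>i<d. trace (transpose (A i) ** X))"

definition OptSDP_R :: "(nat \<Rightarrow> real^'n^'n) \<Rightarrow> nat \<Rightarrow> real" where
  "OptSDP_R A d = Sup {sdp_obj_R A d X | X. sdp_feasible_R X}"

definition sdp_optimal_R :: "(nat \<Rightarrow> real^'n^'n) \<Rightarrow> nat \<Rightarrow> real^'n^'n \<Rightarrow> bool" where
  "sdp_optimal_R A d X \<longleftrightarrow> sdp_feasible_R X \<and>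
     (\<forall>Y. sdp_feasible_R Y \<longrightarrow> sdp_obj_R A d Y \<le> sdp_obj_R A d X)"

definition cinner :: "complex^'n \<Rightarrow> complex^'n \<Rightarrow> complex" where
  "cinner x y = (\<Sum>i\<in>UNIV. cnj (x $ i) * y $ i)"

definition adjoint_mat :: "complex^'n^'n \<Rightarrow> complex^'n^'n" where
  "adjoint_mat A = (\<chi> i j. cnj (A $ j $ i))"

text \<open>Hermitian and positive semidefinite; for Hermitian A the quadratic form is real.\<close>
definition psd_C :: "complex^'n^'n \<Rightarrow> bool" where
  "psd_C A \<longleftrightarrow> adjoint_mat A = A \<and> (\<forall>x. Re (cinner x (A *v x)) \<ge> 0)"

definition Opt_C :: "(nat \<Rightarrow> complex^'n^'n) \<Rightarrow> nat \<Rightarrow> real" where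
  "Opt_C A d = Sup {root d (\<Prod>i<d. Re (cinner x (A i *v x))) | x. cinner x x = 1}"

definition sdp_feasible_C :: "complex^'n^'n \<Rightarrow> bool" where
  "sdp_feasible_C X \<longleftrightarrow> psd_C X \<and> trace X = 1"

definition sdp_obj_C :: "(nat \<Rightarrow> complex^'n^'n) \<Rightarrow> nat \<Rightarrow> complex^'n^'n \<Rightarrow> real" where
  "sdp_obj_C A d X = root d (\<Prod>i<d. Re (trace (adjoint_mat (A i) ** X)))"

definition OptSDP_C :: "(nat \<Rightarrow> complex^'n^'n) \<Rightarrow> nat \<Rightarrow> real" where
  "OptSDP_C A d = Sup {sdp_obj_C A d X | X. sdp_feasible_C X}"

definition sdp_optimal_C :: "(nat \<Rightarrow> complex^'n^'n) \<Rightarrow> nat \<Rightarrow> complex^'n^'n \<Rightarrow> bool" where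
  "sdp_optimal_C A d X \<longleftrightarrow> sdp_feasible_C X \<and>
     (\<forall>Y. sdp_feasible_C Y \<longrightarrow> sdp_obj_C A d Y \<le> sdp_obj_C A d X)"

end

theory Submission
  imports Defs
begin

text \<open>
  Only feasibility of \<open>X\<close> matters for the rounding. Write \<open>X = \<Sum>k<r. u\<^sub>k u\<^sub>k\<^sup>*\<close> with \<open>r\<close> the rank
  (Cholesky) and try \<open>x = \<Sum>k<r. y\<^sub>k u\<^sub>k\<close>, normalised, for independent standard Gaussians \<open>y\<^sub>k\<close>
  over the scalar field. A form \<open>\<langle>x, A\<^sub>i x\<rangle> / \<langle>A\<^sub>i, X\<rangle>\<close> is a convex combination of \<open>\<bar>\<langle>w, y\<rangle>\<bar>\<^sup>2\<close> with unit vectors \<open>w\<close>,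
  so by concavity its expected logarithm is at least that of \<open>\<bar>y\<^sub>1\<bar>\<^sup>2\<close>, while
  \<open>E ln \<parallel>x\<parallel>\<^sup>2 \<le> E ln (\<parallel>y\<parallel>\<^sup>2 / r)\<close> by the tangent bound for the logarithm and the symmetry of \<open>y\<close>;
  the difference of the two constants is \<open>L\<^sub>r\<close>. Logarithms are never integrated: they are compared with
  powers of exponent \<open>\<plusminus>s\<close>, whose Gaussian moments are quotients of Gamma values, and \<open>s \<rightarrow> 0\<close>.
  The bounds on \<open>L\<^sub>r\<close> follow from \<open>\<psi>(x) < ln x\<close>.
\<close>

section \<open>Gaussian and Gamma distributions\<close>

text \<open>Jensen applied directly to the squared norm of x would bound its mean logarithm by the
  logarithm of its mean and lose the dependence on r. Comparing with T = |y|^2 first keeps the exact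
  value of E ln T, which is Digamma (r * DIM / 2), and spends the tangent inequality only on the
  quotient r |x|^2 / T, whose mean is at most 1. The gain, ln (r * DIM / 2) - Digamma (r * DIM / 2),
  is the origin of the rank in the constant. One y has to serve all d forms and the normalisation
  together, so all terms enter a single nonnegative functional and only one first-moment argument is
  made. With nonnegative extended integrals no integrability question arises, and an integrand that
  is infinite at 0 guarantees that no form vanishes at the chosen point. For a fixed small s the
  constant is reached only up to an error e; since the optimum is a supremum, letting e tend to 0 at
  the very end is enough.\<close>

lemma nn_integral_lborel_translate:
  fixes c :: "'a::euclidean_space"
  assumes [measurable]: "f \<in> borel_measurable borel"
  shows "(\<integral>\<^sup>+x. f (c + x) \<partial>lborel) = (\<integral>\<^sup>+x. f x \<partial>lborel)"
proof -
  have "(\<integral>\<^sup>+x. f x \<partial>lborel) = (\<integral>\<^sup>+x. f x \<partial>distr lborel borel ((+) c))"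
    by (simp add: lborel_distr_plus)
  also have "\<dots> = (\<integral>\<^sup>+x. f (c + x) \<partial>lborel)"
    by (subst nn_integral_distr) auto
  finally show ?thesis by simp
qed

text \<open>Uniqueness of Haar measure, in the form of a Fubini argument against the indicator of the unit ball.\<close>
lemma nn_integral_lborel_isometry:
  fixes T S :: "'a::euclidean_space \<Rightarrow> 'a"
  assumes lin: "linear T" and iso: "\<And>x. norm (T x) = norm x" and inv: "\<And>x. T (S x) = x"
    and f[measurable]: "f \<in> borel_measurable borel"
  shows "(\<integral>\<^sup>+x. f (T x) \<partial>lborel) = (\<integral>\<^sup>+x. f x \<partial>lborel)"
proof -
  have T[measurable]: "T \<in> borel_measurable borel"
    using lin by (intro borel_measurable_continuous_onI linear_continuous_on)
      (simp add: linear_conv_bounded_linear)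
  define g :: "'a \<Rightarrow> ennreal" where "g = indicator (ball 0 1)"
  have g[measurable]: "g \<in> borel_measurable borel" unfolding g_def by (intro borel_measurable_indicator borel_open open_ball)
  have gT: "g (- T x) = g x" for x
    unfolding g_def by (auto simp: indicator_def iso)
  have trans_g: "(\<integral>\<^sup>+y. g (y - c) \<partial>lborel) = (\<integral>\<^sup>+y. g y \<partial>lborel)" for c
    using nn_integral_lborel_translate[OF g, of "- c"] by simp
  have B: "(\<integral>\<^sup>+y. g y \<partial>lborel) = ennreal (unit_ball_vol (DIM('a)))"
    unfolding g_def by (simp add: emeasure_ball)
  have "(\<integral>\<^sup>+x. f (T x) \<partial>lborel) * (\<integral>\<^sup>+y. g y \<partial>lborel)
     = (\<integral>\<^sup>+x. \<integral>\<^sup>+y. f (T x) * g (y - T x) \<partial>lborel \<partial>lborel)"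
    by (simp add: nn_integral_cmult nn_integral_multc trans_g)
  also have "\<dots> = (\<integral>\<^sup>+y. \<integral>\<^sup>+x. f (T x) * g (y - T x) \<partial>lborel \<partial>lborel)"
    by (rule lborel_pair.Fubini') measurable
  also have "\<dots> = (\<integral>\<^sup>+y. \<integral>\<^sup>+x. f (T x + y) * g x \<partial>lborel \<partial>lborel)"
  proof (rule nn_integral_cong)
    \<comment> \<open>Translating by \<open>S y\<close> turns the argument of \<open>f\<close> into
      \<open>T x + y\<close> and leaves \<open>g (- T x)\<close>, which equals \<open>g x\<close>
      because \<open>T\<close> preserves norms and the ball is symmetric.\<close>
    fix y :: 'a
    have "(\<integral>\<^sup>+x. f (T x) * g (y - T x) \<partial>lborel)
        = (\<integral>\<^sup>+x. f (T (S y + x)) * g (y - T (S y + x)) \<partial>lborel)"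
      by (rule nn_integral_lborel_translate[symmetric]) measurable
    also have "\<dots> = (\<integral>\<^sup>+x. f (T x + y) * g x \<partial>lborel)"
      by (simp add: linear_add[OF lin] inv gT add.commute)
    finally show "(\<integral>\<^sup>+x. f (T x) * g (y - T x) \<partial>lborel) = (\<integral>\<^sup>+x. f (T x + y) * g x \<partial>lborel)" .
  qed
  also have "\<dots> = (\<integral>\<^sup>+x. \<integral>\<^sup>+y. f (T x + y) * g x \<partial>lborel \<partial>lborel)"
    by (rule lborel_pair.Fubini') measurable
  also have "\<dots> = (\<integral>\<^sup>+x. f x \<partial>lborel) * (\<integral>\<^sup>+y. g y \<partial>lborel)"
    by (simp add: nn_integral_cmult nn_integral_multc nn_integral_lborel_translate)
  finally have "(\<integral>\<^sup>+x. f (T x) \<partial>lborel) = (\<integral>\<^sup>+x. f x \<partial>lborel) \<or> unit_ball_vol (real DIM('a)) \<le> 0"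
    unfolding B mult_right_ennreal_cancel .
  moreover have "unit_ball_vol (real DIM('a)) > 0" by (rule unit_ball_vol_pos) simp
  ultimately show ?thesis using not_le by blast
qed

text \<open>A substitute for polar coordinates. Half-lines generate the Borel sets and are stable
  under intersection; the preimage of one is a ball of radius sqrt a, of volume proportional to
  a^(m/2), and the density is the derivative of that volume.\<close>

lemma distr_norm_square_lborel:
  "distr lborel borel (\<lambda>z::'a::euclidean_space. (norm z)\<^sup>2) =
     density lborel (\<lambda>t. ennreal (indicator {0..} t *
        (unit_ball_vol (DIM('a)) * (DIM('a) / 2) * t powr (DIM('a) / 2 - 1))))"
  (is "?M = ?N")
proof (rule measure_eqI_generator_eq[where E="range (\<lambda>a. {..a::real})" and \<Omega>=UNIV and A="\<lambda>n. {..real n}"])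
  let ?m = "real DIM('a)" and ?c = "unit_ball_vol (DIM('a))"
  have m: "?m > 0" by simp
  have M: "emeasure ?M {..a} = ennreal (?c * a powr (?m / 2))" if "a \<ge> 0" for a
  proof -
    have "emeasure ?M {..a} = emeasure lborel ((\<lambda>z::'a. (norm z)\<^sup>2) -` {..a} \<inter> space lborel)"
      by (intro emeasure_distr) auto
    also have "(\<lambda>z::'a. (norm z)\<^sup>2) -` {..a} \<inter> space lborel = cball 0 (sqrt a)"
      using that by (auto simp: real_le_rsqrt power2_eq_square) (metis norm_ge_zero power2_eq_square power_mono real_sqrt_pow2)
    also have "emeasure lborel \<dots> = ennreal (?c * sqrt a ^ DIM('a))"
      using that by (intro emeasure_cball) auto
    also have "sqrt a ^ DIM('a) = a powr (?m / 2)"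
      using that by (cases "a = 0") (auto simp: powr_half_sqrt[symmetric] powr_realpow[symmetric] powr_powr)
    finally show ?thesis .
  qed
  have N: "emeasure ?N {..a} = ennreal (?c * a powr (?m / 2))" if "a \<ge> 0" for a
  proof -
    have "((\<lambda>t. t powr (?m / 2 - 1)) has_integral (a powr (?m / 2 - 1 + 1) / (?m / 2 - 1 + 1))) {0..a}"
      using that m by (intro has_integral_powr_from_0) (auto simp: field_simps)
    from has_integral_mult_right[OF this, of "?c * (?m/2)"]
    have I: "((\<lambda>t. ?c * (?m / 2) * t powr (?m / 2 - 1)) has_integral (?c * a powr (?m / 2))) {0..a}"
      using m by simp
    have "emeasure ?N {..a} = (\<integral>\<^sup>+t. ennreal (indicator {0..} t * (?c * (?m / 2) * t powr (?m / 2 - 1))) * indicator {..a} t \<partial>lborel)"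
      by (intro emeasure_density) auto
    also have "\<dots> = (\<integral>\<^sup>+t. ennreal (indicator {0..a} t * (?c * (?m / 2) * t powr (?m / 2 - 1))) \<partial>lborel)"
      by (intro nn_integral_cong) (auto simp: indicator_def)
    also have "\<dots> = ennreal (?c * a powr (?m / 2))"
      using nn_integral_has_integral_lebesgue[OF _ I] by simp
    finally show ?thesis .
  qed
  show "Int_stable (range (\<lambda>a. {..a::real}))"
    by (auto simp: Int_stable_def)
  show "emeasure ?M X = emeasure ?N X" if "X \<in> range (\<lambda>a. {..a::real})" for X
  proof -
    from that obtain a where X: "X = {..a}" by blast
    show ?thesis
    proof (cases "a \<ge> 0")
      case True then show ?thesis using M N X by simp
    next
      case False
      have "emeasure ?M X = emeasure lborel ((\<lambda>z::'a. (norm z)\<^sup>2) -` {..a} \<inter> space lborel)"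
        unfolding X by (intro emeasure_distr) auto
      moreover have "\<not> (norm z)\<^sup>2 \<le> a" for z :: 'a
        using False zero_le_power2[of "norm z"] by linarith
      then have "(\<lambda>z::'a. (norm z)\<^sup>2) -` {..a} = {}" by blast
      ultimately have "emeasure ?M X = 0" by simp
      moreover have "emeasure ?N X = (\<integral>\<^sup>+t. ennreal (indicator {0..} t * (?c * (?m / 2) * t powr (?m / 2 - 1))) * indicator {..a} t \<partial>lborel)"
        unfolding X by (intro emeasure_density) auto
      moreover have "\<dots> = (\<integral>\<^sup>+t. 0 \<partial>(lborel::real measure))"
        using False by (intro nn_integral_cong) (auto simp: indicator_def)
      ultimately show ?thesis by simp
    qed
  qed
  show "sets ?M = sigma_sets UNIV (range (\<lambda>a. {..a::real}))"
    by (simp add: borel_eq_atMost)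
  show "sets ?N = sigma_sets UNIV (range (\<lambda>a. {..a::real}))"
    by (simp add: borel_eq_atMost)
  show "emeasure ?M {..real n} \<noteq> \<infinity>" for n by (simp add: M)
  show "(\<Union>n. {..real n}) = UNIV" by (auto intro: real_arch_simple)
qed auto

section \<open>The Gamma and Gaussian laws and their moments\<close>

definition gamma_distr :: "real \<Rightarrow> real measure" where
  "gamma_distr a = density lborel (\<lambda>t. ennreal (indicator {0..} t * t powr (a - 1) * exp (- t) / Gamma a))"

text \<open>The exponent carries no factor 1/2, so that the squared norm has the Gamma law of shape
  DIM/2 and rate 1 over both fields. Over the reals this is the standard Gaussian divided by sqrt 2,
  which is harmless because the rounded vector is normalised.\<close>

definition gauss :: "'a::euclidean_space measure" where
  "gauss = density lborel (\<lambda>z. ennreal (exp (- (norm z)\<^sup>2) / pi powr (DIM('a) / 2)))"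

lemma sets_gamma_distr [simp, measurable_cong]: "sets (gamma_distr a) = sets borel"
  and space_gamma_distr [simp]: "space (gamma_distr a) = UNIV"
  by (simp_all add: gamma_distr_def)

lemma sets_gauss [simp, measurable_cong]: "sets gauss = sets borel"
  and space_gauss [simp]: "space gauss = UNIV"
  by (simp_all add: gauss_def)

lemma nn_integral_gamma_distr:
  assumes [measurable]: "f \<in> borel_measurable borel"
  shows "(\<integral>\<^sup>+t. f t \<partial>gamma_distr a) = 
    (\<integral>\<^sup>+t. ennreal (indicator {0..} t * t powr (a - 1) * exp (- t) / Gamma a) * f t \<partial>lborel)"
  unfolding gamma_distr_def by (subst nn_integral_density) auto

lemma nn_integral_gauss:
  assumes [measurable]: "f \<in> borel_measurable borel"
  shows "(\<integral>\<^sup>+z. f z \<partial>(gauss::'a::euclidean_space measure)) = 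
    (\<integral>\<^sup>+z. ennreal (exp (- (norm z)\<^sup>2) / pi powr (DIM('a) / 2)) * f z \<partial>lborel)"
  unfolding gauss_def by (subst nn_integral_density) auto

text \<open>Raising to a power only shifts the exponent in Euler's integral. Both signs of
  \<open>s\<close> occur later: positive for the squared norm of y, negative for the linear
  forms.\<close>

lemma nn_integral_gamma_distr_powr:
  assumes "a > 0" "a + s > 0"
  shows "(\<integral>\<^sup>+t. ennreal (t powr s) \<partial>gamma_distr a) = ennreal (Gamma (a + s) / Gamma a)"
proof -
  have G: "Gamma a > 0" "Gamma (a + s) > 0" using assms by (auto intro: Gamma_real_pos)
  have "(\<integral>\<^sup>+t. ennreal (t powr s) \<partial>gamma_distr a) =
    (\<integral>\<^sup>+t. ennreal (1 / Gamma a) * ennreal (indicator {0..} t * t powr (a + s - 1) / exp t) \<partial>lborel)"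
    using G
    by (subst nn_integral_gamma_distr, measurable, intro nn_integral_cong)
      (auto simp: ennreal_mult'[symmetric] indicator_def exp_minus field_simps powr_add[symmetric])
  also have "\<dots> = ennreal (1 / Gamma a) * ennreal (Gamma (a + s))"
    by (subst nn_integral_cmult) (auto simp: Gamma_conv_nn_integral_real[OF assms(2)])
  finally show ?thesis using G by (simp add: ennreal_mult'[symmetric])
qed

lemma emeasure_gamma_distr:
  assumes "a > 0" shows "emeasure (gamma_distr a) UNIV = 1"
proof -
  have G: "Gamma a > 0" using assms by (auto intro: Gamma_real_pos)
  have "(\<integral>\<^sup>+t. 1 \<partial>gamma_distr a) =
    (\<integral>\<^sup>+t. ennreal (1 / Gamma a) * ennreal (indicator {0..} t * t powr (a - 1) / exp t) \<partial>lborel)"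
    unfolding nn_integral_gamma_distr[OF borel_measurable_const] using G
    by (intro nn_integral_cong)
      (auto simp: ennreal_mult'[symmetric] indicator_def exp_minus field_simps)
  also have "\<dots> = ennreal (1 / Gamma a) * ennreal (Gamma a)"
    by (subst nn_integral_cmult) (auto simp: Gamma_conv_nn_integral_real[OF assms])
  finally show ?thesis using G by (simp add: ennreal_mult'[symmetric])
qed

lemma nn_integral_gauss_norm:
  assumes [measurable]: "f \<in> borel_measurable borel"
  shows "(\<integral>\<^sup>+z. f ((norm z)\<^sup>2) \<partial>(gauss::'a::euclidean_space measure)) = (\<integral>\<^sup>+t. f t \<partial>gamma_distr (DIM('a) / 2))"
proof -
  let ?m = "real DIM('a)" and ?c = "unit_ball_vol (DIM('a))"
  have G: "Gamma (?m/2) > 0" by (auto intro: Gamma_real_pos)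
  have G1: "Gamma (?m / 2 + 1) = ?m / 2 * Gamma (?m/2)"
    by (intro Gamma_plus1) (use nonpos_Ints_nonpos[of "?m / 2"] in auto)
  \<comment> \<open>The unit ball has volume pi^(m/2) / Gamma (m/2 + 1), so the radial constant and
    the Gaussian normaliser collapse to that of the Gamma law.\<close>
  have c: "?c * (?m / 2) / pi powr (?m / 2) = 1 / Gamma (?m / 2)"
    unfolding unit_ball_vol_def using G1 by simp
  have "(\<integral>\<^sup>+z. f ((norm z)\<^sup>2) \<partial>(gauss::'a::euclidean_space measure)) =
     (\<integral>\<^sup>+t. ennreal (exp (- t) / pi powr (?m / 2)) * f t \<partial>distr lborel borel (\<lambda>z::'a. (norm z)\<^sup>2))"
    by (subst nn_integral_gauss) (auto simp: nn_integral_distr)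
  also have "\<dots> = (\<integral>\<^sup>+t. ennreal (indicator {0..} t * (?c * (?m / 2) * t powr (?m / 2 - 1))) *
       (ennreal (exp (- t) / pi powr (?m / 2)) * f t) \<partial>lborel)"
    unfolding distr_norm_square_lborel by (intro nn_integral_density) auto
  also have "\<dots> = (\<integral>\<^sup>+t. f t \<partial>gamma_distr (DIM('a) / 2))"
    unfolding nn_integral_gamma_distr[OF assms]
  proof (intro nn_integral_cong)
    fix t :: real
    have "indicator {0..} t * (?c * (?m / 2) * t powr (?m / 2 - 1)) * (exp (- t) / pi powr (?m / 2)) = 
        indicator {0..} t * t powr (?m / 2 - 1) * exp (- t) * (?c * (?m / 2) / pi powr (?m / 2))" by simp
    then have e: "indicator {0..} t * (?c * (?m / 2) * t powr (?m / 2 - 1)) * (exp (- t) / pi powr (?m / 2)) = 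
        indicator {0..} t * t powr (?m / 2 - 1) * exp (- t) / Gamma (?m / 2)" unfolding c by simp
    show "ennreal (indicator {0..} t * (?c * (?m / 2) * t powr (?m / 2 - 1))) *
       (ennreal (exp (- t) / pi powr (?m / 2)) * f t) = 
       ennreal (indicator {0..} t * t powr (?m / 2 - 1) * exp (- t) / Gamma (?m / 2)) * f t"
      unfolding e[symmetric] mult.assoc[symmetric] 
      by (subst ennreal_mult''[symmetric]) auto
  qed
  finally show ?thesis .
qed

lemma emeasure_gauss: "emeasure (gauss::'a::euclidean_space measure) UNIV = 1"
proof -
  have "emeasure (gauss::'a measure) UNIV = (\<integral>\<^sup>+z. (\<lambda>_. 1) ((norm z)\<^sup>2) \<partial>(gauss::'a measure))" by simp
  also have "\<dots> = emeasure (gamma_distr (DIM('a) / 2)) UNIV"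
    by (subst nn_integral_gauss_norm) auto
  finally show ?thesis by (simp add: emeasure_gamma_distr)
qed

lemma sigma_finite_gauss: "sigma_finite_measure (gauss::'a::euclidean_space measure)"
  by (intro finite_measure.axioms(1) finite_measureI) (simp add: emeasure_gauss)

lemma sigma_finite_gamma_distr: "a > 0 \<Longrightarrow> sigma_finite_measure (gamma_distr a)"
  by (intro finite_measure.axioms(1) finite_measureI) (simp add: emeasure_gamma_distr)

text \<open>The Beta integral is not evaluated: it is the normalising constant, found by inserting \<^term>\<open>f = (\<lambda>_. 1)\<close>.\<close>
lemma nn_integral_gamma_distr_add:
  assumes a: "a > 0" and b: "b > 0" and f[measurable]: "f \<in> borel_measurable borel"
  shows "(\<integral>\<^sup>+t. \<integral>\<^sup>+u. f (t + u) \<partial>gamma_distr b \<partial>gamma_distr a) = (\<integral>\<^sup>+t. f t \<partial>gamma_distr (a + b))"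
proof -
  interpret gb: sigma_finite_measure "gamma_distr b" by (rule sigma_finite_gamma_distr[OF b])
  have G: "Gamma a > 0" "Gamma b > 0" "Gamma (a + b) > 0" using a b by (auto intro: Gamma_real_pos)
  define B :: ennreal where "B = (\<integral>\<^sup>+x. ennreal (indicator {0..1} x * (x powr (a - 1) * (1 - x) powr (b - 1) / (Gamma a * Gamma b))) \<partial>lborel)"
  have key: "(\<integral>\<^sup>+t. \<integral>\<^sup>+u. f (t + u) \<partial>gamma_distr b \<partial>gamma_distr a)
    = B * (\<integral>\<^sup>+v. ennreal (indicator {0..} v * (v powr (a + b - 1) * exp (- v))) * f v \<partial>lborel)"
    if f[measurable]: "f \<in> borel_measurable borel" for f
  proof -
    let ?k = "\<lambda>t v. ennreal (indicator {0..v} t * (t powr (a - 1) * (v - t) powr (b - 1) / (Gamma a * Gamma b) * exp (-v)))"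
    have m1: "(\<lambda>t. \<integral>\<^sup>+u. f (t + u) \<partial>gamma_distr b) \<in> borel_measurable borel" by measurable
    have "(\<integral>\<^sup>+t. \<integral>\<^sup>+u. f (t + u) \<partial>gamma_distr b \<partial>gamma_distr a) =
       (\<integral>\<^sup>+t. \<integral>\<^sup>+v. ?k t v * f v \<partial>lborel \<partial>lborel)"
      unfolding nn_integral_gamma_distr[OF m1]
    proof (rule nn_integral_cong)
      fix t :: real
      have "(\<integral>\<^sup>+u. f (t + u) \<partial>gamma_distr b) = 
        (\<integral>\<^sup>+u. ennreal (indicator {0..} u * u powr (b - 1) * exp (- u) / Gamma b) * f (t + u) \<partial>lborel)"
        by (rule nn_integral_gamma_distr) measurable
      also have "\<dots> = (\<integral>\<^sup>+v. ennreal (indicator {0..} (- t + v) * (- t + v) powr (b - 1) * exp (- (- t + v)) / Gamma b) * f (t + (- t + v)) \<partial>lborel)"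
        by (rule nn_integral_lborel_translate[symmetric]) measurable
      finally have "ennreal (indicator {0..} t * t powr (a - 1) * exp (- t) / Gamma a) * (\<integral>\<^sup>+u. f (t + u) \<partial>gamma_distr b)
        = (\<integral>\<^sup>+v. ennreal (indicator {0..} t * t powr (a - 1) * exp (- t) / Gamma a) * (ennreal (indicator {0..} (- t + v) * (- t + v) powr (b - 1) * exp (- (- t + v)) / Gamma b) * f v) \<partial>lborel)"
        by (subst nn_integral_cmult) auto
      also have "\<dots> = (\<integral>\<^sup>+v. ?k t v * f v \<partial>lborel)"
      proof (rule nn_integral_cong)
        fix v :: real
        have "ennreal (indicator {0..} t * t powr (a - 1) * exp (- t) / Gamma a) * ennreal (indicator {0..} (- t + v) * (- t + v) powr (b - 1) * exp (- (- t + v)) / Gamma b) = ?k t v"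
          using G by (subst ennreal_mult'[symmetric])
            (auto simp: indicator_def exp_diff exp_minus field_simps)
        then show "ennreal (indicator {0..} t * t powr (a - 1) * exp (- t) / Gamma a) * (ennreal (indicator {0..} (- t + v) * (- t + v) powr (b - 1) * exp (- (- t + v)) / Gamma b) * f v) = ?k t v * f v"
          by (simp add: mult.assoc[symmetric])
      qed
      finally show "ennreal (indicator {0..} t * t powr (a - 1) * exp (- t) / Gamma a) * (\<integral>\<^sup>+u. f (t + u) \<partial>gamma_distr b)
        = (\<integral>\<^sup>+v. ?k t v * f v \<partial>lborel)" .
    qed
    also have "\<dots> = (\<integral>\<^sup>+v. \<integral>\<^sup>+t. ?k t v * f v \<partial>lborel \<partial>lborel)"
    proof (rule lborel_pair.Fubini')
      have eq: "?k t v = ennreal ((if 0 \<le> t \<and> t \<le> v then 1 else 0) * (t powr (a - 1) * (v - t) powr (b - 1) / (Gamma a * Gamma b) * exp (-v)))" for t v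
        by (auto simp: indicator_def)
      show "(\<lambda>(v, t). ?k t v * f v) \<in> borel_measurable (lborel \<Otimes>\<^sub>M lborel)"
        unfolding eq by measurable
    qed
    also have "\<dots> = (\<integral>\<^sup>+v. B * (ennreal (indicator {0..} v * (v powr (a + b - 1) * exp (- v))) * f v) \<partial>lborel)"
    \<comment> \<open>The substitution t = v * x below degenerates at v = 0, a null set.\<close>
    proof (rule nn_integral_cong_AE, rule AE_mp[OF AE_lborel_singleton[of 0]], rule AE_I2, rule impI)
      fix v :: real assume v0: "v \<noteq> 0"
      show "(\<integral>\<^sup>+t. ?k t v * f v \<partial>lborel) = B * (ennreal (indicator {0..} v * (v powr (a + b - 1) * exp (- v))) * f v)"
      proof (cases "v > 0")
        case False
        then have "(\<integral>\<^sup>+t. ?k t v * f v \<partial>lborel) = (\<integral>\<^sup>+t. 0 \<partial>(lborel::real measure))"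
          using v0 by (intro nn_integral_cong) (auto simp: indicator_def)
        then show ?thesis using False v0 by (auto simp: indicator_def)
      next
        \<comment> \<open>Substituting t = v * x splits the convolution kernel into the Beta
          integrand in x and the factor v^(a+b-1) * exp (-v).\<close>
        case v: True
        have "(\<integral>\<^sup>+t. ?k t v * f v \<partial>lborel) = (\<integral>\<^sup>+t. ?k t v \<partial>lborel) * f v"
          by (intro nn_integral_multc) auto
        also have "(\<integral>\<^sup>+t. ?k t v \<partial>lborel) = ennreal \<bar>v\<bar> * (\<integral>\<^sup>+x. ?k (0 + v * x) v \<partial>lborel)"
          using v by (intro nn_integral_real_affine[of "\<lambda>t. ?k t v" v 0]) auto
        also have "\<dots> = (\<integral>\<^sup>+x. ennreal v * ?k (v * x) v \<partial>lborel)"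
          using v by (subst nn_integral_cmult) auto
        also have "\<dots> = (\<integral>\<^sup>+x. ennreal (indicator {0..1} x * (x powr (a - 1) * (1 - x) powr (b - 1) / (Gamma a * Gamma b))) * ennreal (v powr (a + b - 1) * exp (- v)) \<partial>lborel)"
        proof (rule nn_integral_cong)
          fix x :: real
          show "ennreal v * ?k (v * x) v = ennreal (indicator {0..1} x * (x powr (a - 1) * (1 - x) powr (b - 1) / (Gamma a * Gamma b))) * ennreal (v powr (a + b - 1) * exp (- v))"
          proof (cases "0 \<le> x \<and> x \<le> 1")
            case False
            then have "v * x \<notin> {0..v}" using v by (auto simp: zero_le_mult_iff)
            with False show ?thesis by (auto simp: indicator_def)
          next
            case True
            then have 1: "v * x \<in> {0..v}" using v by (auto simp: mult_left_le)
            have 2: "(v * x) powr (a - 1) = v powr (a - 1) * x powr (a - 1)"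
              by (rule powr_mult)
            have "v - v * x = v * (1 - x)" by (simp add: algebra_simps)
            then have 3: "(v - v * x) powr (b - 1) = v powr (b - 1) * (1 - x) powr (b - 1)"
              using True v by (simp add: powr_mult)
            have 4: "v powr (a + b - 1) = v * (v powr (a - 1) * v powr (b - 1))"
              using v powr_add[of v "a - 1" "b - 1"] powr_add[of v 1 "a + b - 2"] by (simp add: algebra_simps)
            show ?thesis
              using 1 True v G unfolding 2 3 4
              by (subst (1 2) ennreal_mult'[symmetric]) (auto simp: indicator_def field_simps)
          qed
        qed
        also have "\<dots> = B * ennreal (v powr (a + b - 1) * exp (- v))"
          unfolding B_def by (intro nn_integral_multc) auto
        finally show ?thesis using v by (simp add: mult.assoc)
      qed
    qed
    also have "\<dots> = B * (\<integral>\<^sup>+v. ennreal (indicator {0..} v * (v powr (a + b - 1) * exp (- v))) * f v \<partial>lborel)"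
      by (intro nn_integral_cmult) auto
    finally show ?thesis .
  qed
  have scale: "(\<integral>\<^sup>+v. ennreal (indicator {0..} v * (v powr (a + b - 1) * exp (- v))) * f v \<partial>lborel)
     = ennreal (Gamma (a + b)) * (\<integral>\<^sup>+v. f v \<partial>gamma_distr (a + b))"
    if f[measurable]: "f \<in> borel_measurable borel" for f
    unfolding nn_integral_gamma_distr[OF f]
    using G by (subst nn_integral_cmult[symmetric], measurable, intro nn_integral_cong) (auto simp: mult.assoc[symmetric] ennreal_mult'[symmetric])
  have B1: "1 = B * ennreal (Gamma (a + b))"
    using key[of "\<lambda>_. 1"] scale[of "\<lambda>_. 1"] a b
    by (simp add: emeasure_gamma_distr)
  then show ?thesis
    unfolding key[OF f] scale[OF f] by (simp only: mult.assoc[symmetric] B1[symmetric] mult_1)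
qed

section \<open>Conjugation on the scalar field\<close>

text \<open>One abstract scalar field covers both cases: \<open>cj\<close> becomes the identity on
  the reals and \<open>cnj\<close> on the complex numbers. \<open>mult_cj\<close> ties conjugation
  to the norm, and the dimension of the field over the reals enters only through the shape DIM/2 of
  the Gamma law.\<close>

locale conj_field =
  fixes cj :: "'a::{real_normed_field,euclidean_space} \<Rightarrow> 'a"
  assumes cj_add: "cj (x + y) = cj x + cj y"
    and cj_mult: "cj (x * y) = cj x * cj y"
    and cj_cj: "cj (cj x) = x"
    and mult_cj: "x * cj x = of_real ((norm x)\<^sup>2)"
begin

lemma cj_0 [simp]: "cj 0 = 0"
  using cj_add[of 0 0] by simp

lemma cj_of_real [simp]: "cj (of_real t) = of_real t"
proof (cases "t = 0")
  case False
  have "of_real t * cj (of_real t) = (of_real t * of_real t :: 'a)"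
    using mult_cj[of "of_real t"] by (simp add: power2_eq_square)
  with False show ?thesis by simp
qed simp

lemma cj_1 [simp]: "cj 1 = 1"
  using cj_of_real[of 1] by simp

lemma cj_minus: "cj (- x) = - cj x"
  using cj_add[of x "- x"] by (simp add: eq_neg_iff_add_eq_0 add.commute)

lemma cj_diff: "cj (x - y) = cj x - cj y"
  using cj_add[of x "- y"] by (simp add: cj_minus)

lemma cj_sum: "cj (sum f A) = (\<Sum>i\<in>A. cj (f i))"
  by (induction A rule: infinite_finite_induct) (auto simp: cj_add)

lemma norm_cj [simp]: "norm (cj x) = norm x"
proof -
  have "of_real ((norm (cj x))\<^sup>2) = (of_real ((norm x)\<^sup>2) :: 'a)"
    using mult_cj[of "cj x"] mult_cj[of x] by (simp add: cj_cj mult.commute)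
  then have "(norm (cj x))\<^sup>2 = (norm x)\<^sup>2" by (simp only: of_real_eq_iff)
  then show ?thesis by (simp add: power2_eq_iff_nonneg)
qed

text \<open>The two expressions are the image of (z, w) under the matrix with rows (a, b) and (- cj
  b, cj a), the completion of a unit row to a unitary matrix; the cross terms cancel.\<close>

lemma norm_unitary_square_sum:
  assumes "(norm a)\<^sup>2 + (norm b)\<^sup>2 = 1"
  shows "(norm (a * z + b * w))\<^sup>2 + (norm (cj a * w - cj b * z))\<^sup>2 = (norm z)\<^sup>2 + (norm w)\<^sup>2"
proof -
  have "a * cj a + b * cj b = of_real ((norm a)\<^sup>2 + (norm b)\<^sup>2)"
    by (simp only: mult_cj of_real_add)
  then have ab: "a * cj a + b * cj b = 1" using assms by simp
  have "(of_real ((norm (a * z + b * w))\<^sup>2 + (norm (cj a * w - cj b * z))\<^sup>2) :: 'a)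
    = (a * z + b * w) * (cj a * cj z + cj b * cj w) + (cj a * w - cj b * z) * (a * cj w - b * cj z)"
    unfolding of_real_add mult_cj[symmetric] by (simp add: cj_add cj_mult cj_diff cj_cj)
  also have "\<dots> = (a * cj a + b * cj b) * (z * cj z + w * cj w)"
    by (simp add: algebra_simps)
  also have "\<dots> = of_real ((norm z)\<^sup>2 + (norm w)\<^sup>2)"
    unfolding ab by (simp only: mult_cj of_real_add mult_1)
  finally show ?thesis by (simp only: of_real_eq_iff)
qed

lemma parallelogram_identity:
  "(norm (a + b))\<^sup>2 + (norm (a - b))\<^sup>2 = 2 * ((norm a)\<^sup>2 + (norm b)\<^sup>2)"
  for a b :: 'a
  by (simp add: power2_norm_eq_inner inner_add inner_diff algebra_simps)

text \<open>The unit row (a, b) is completed to a unitary map of pairs. It preserves Lebesgue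
  measure as well as the product density, which depends only on the norm of the pair; the second
  coordinate is then integrated out.\<close>

lemma nn_integral_gauss_rotate:
  fixes a b :: 'a
  assumes ab: "(norm a)\<^sup>2 + (norm b)\<^sup>2 = 1" and f[measurable]: "f \<in> borel_measurable borel"
  shows "(\<integral>\<^sup>+z. \<integral>\<^sup>+w. f (a * z + b * w) \<partial>gauss \<partial>gauss) = (\<integral>\<^sup>+z. f z \<partial>gauss)"
proof -
  let ?c = "pi powr (DIM('a) / 2)"
  define T :: "'a \<times> 'a \<Rightarrow> 'a \<times> 'a" where "T = (\<lambda>(z, w). (a * z + b * w, cj a * w - cj b * z))"
  \<comment> \<open>The conjugate transpose of the matrix of \<open>T\<close>, hence its
    inverse.\<close>
  define S :: "'a \<times> 'a \<Rightarrow> 'a \<times> 'a" where "S = (\<lambda>(z, w). (cj a * z - b * w, a * w + cj b * z))"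
  define F :: "'a \<times> 'a \<Rightarrow> ennreal" where
    "F = (\<lambda>(z, w). ennreal (exp (- (norm z)\<^sup>2) / ?c) * (ennreal (exp (- (norm w)\<^sup>2) / ?c) * f z))"
  have F[measurable]: "F \<in> borel_measurable borel"
    unfolding F_def borel_prod[symmetric] by measurable
  have ab': "a * cj a + b * cj b = 1"
    using ab by (simp only: mult_cj of_real_add[symmetric] of_real_1)
  have TS: "T (S p) = p" for p
  proof -
    have "a * (cj a * z - b * w) + b * (a * w + cj b * z) = (a * cj a + b * cj b) * z"
      "cj a * (a * w + cj b * z) - cj b * (cj a * z - b * w) = (a * cj a + b * cj b) * w" for z w
      by (simp_all add: algebra_simps)
    then show ?thesis by (simp add: T_def S_def ab' split: prod.split)
  qed
  have lin: "linear T"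
    unfolding T_def by (rule linearI) (auto simp: algebra_simps scaleR_conv_of_real split: prod.splits)
  have [measurable]: "T \<in> borel_measurable borel"
    using lin by (intro borel_measurable_continuous_onI linear_continuous_on)
      (simp add: linear_conv_bounded_linear)
  have iso: "norm (T p) = norm p" for p
    using norm_unitary_square_sum[OF ab, of "fst p" "snd p"]
    by (cases p) (simp add: T_def norm_Pair)
  have exp_F: "F (T (z, w)) = ennreal (exp (- (norm z)\<^sup>2) / ?c) * (ennreal (exp (- (norm w)\<^sup>2) / ?c) * f (a * z + b * w))" for z w
  proof -
    have "exp (- (norm (a * z + b * w))\<^sup>2) / ?c * (exp (- (norm (cj a * w - cj b * z))\<^sup>2) / ?c)
        = exp (- (norm z)\<^sup>2) / ?c * (exp (- (norm w)\<^sup>2) / ?c)"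
      using norm_unitary_square_sum[OF ab, of z w] by (simp add: exp_add[symmetric])
    then show ?thesis
      unfolding F_def T_def by (simp add: mult.assoc[symmetric] ennreal_mult'[symmetric])
  qed
  have "(\<integral>\<^sup>+z. \<integral>\<^sup>+w. f (a * z + b * w) \<partial>gauss \<partial>gauss) = (\<integral>\<^sup>+z. \<integral>\<^sup>+w. F (T (z, w)) \<partial>lborel \<partial>lborel)"
  proof -
    interpret g: sigma_finite_measure "gauss :: 'a measure" by (rule sigma_finite_gauss)
    show ?thesis
      unfolding exp_F
      by (subst nn_integral_gauss, measurable, intro nn_integral_cong, subst nn_integral_gauss, measurable)
        (simp add: nn_integral_cmult)
  qed
  also have "\<dots> = (\<integral>\<^sup>+p. F (T p) \<partial>(lborel \<Otimes>\<^sub>M lborel))"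
    by (intro lborel.nn_integral_fst) (simp add: borel_prod lborel_prod)
  also have "\<dots> = (\<integral>\<^sup>+p. F p \<partial>lborel)"
    unfolding lborel_prod by (intro nn_integral_lborel_isometry[OF lin iso TS F])
  also have "\<dots> = (\<integral>\<^sup>+z. \<integral>\<^sup>+w. F (z, w) \<partial>lborel \<partial>lborel)"
    unfolding lborel_prod[symmetric] by (intro lborel.nn_integral_fst[symmetric]) (simp add: borel_prod lborel_prod)
  also have "\<dots> = (\<integral>\<^sup>+z. ennreal (exp (- (norm z)\<^sup>2) / ?c) * f z * (\<integral>\<^sup>+w. ennreal (exp (- (norm w)\<^sup>2) / ?c) * 1 \<partial>(lborel::'a measure)) \<partial>lborel)"
    unfolding F_def by (intro nn_integral_cong) (simp add: nn_integral_cmult[symmetric] mult_ac)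
  also have "(\<integral>\<^sup>+w. ennreal (exp (- (norm w)\<^sup>2) / ?c) * 1 \<partial>(lborel::'a measure)) = 1"
    by (subst nn_integral_gauss[symmetric]) (auto simp: emeasure_gauss)
  finally show ?thesis by (simp add: nn_integral_gauss)
qed

end

section \<open>Products of Gaussians\<close>

lemma product_sigma_finite_gauss: "product_sigma_finite (\<lambda>_::'i. gauss :: 'a::euclidean_space measure)"
  by (intro product_sigma_finite.intro sigma_finite_gauss)

lemma nn_integral_PiM_gauss_insert:
  assumes "finite J" "i \<notin> J" and "f \<in> borel_measurable (PiM (insert i J) (\<lambda>_. gauss))"
  shows "(\<integral>\<^sup>+y. f y \<partial>PiM (insert i J) (\<lambda>_. gauss :: 'a::euclidean_space measure)) =
    (\<integral>\<^sup>+z. \<integral>\<^sup>+y. f (y(i := z)) \<partial>PiM J (\<lambda>_. gauss) \<partial>gauss)"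
  using assms by (intro product_sigma_finite.product_nn_integral_insert_rev product_sigma_finite_gauss)

lemma sum_fun_upd_insert:
  assumes "finite J" "i \<notin> J"
  shows "(\<Sum>k\<in>insert i J. g k ((y(i := z)) k)) = g i z + (\<Sum>k\<in>J. g k (y k) :: 'b::comm_monoid_add)"
proof -
  have "(\<Sum>k\<in>J. g k ((y(i := z)) k)) = (\<Sum>k\<in>J. g k (y k))"
    using assms by (intro sum.cong) auto
  then show ?thesis using assms by simp
qed

text \<open>Each squared coordinate has Gamma shape DIM/2, and shapes add under convolution.
  \<open>J\<close> must be nonempty since there is no Gamma law of shape 0.\<close>

lemma nn_integral_PiM_gauss_norm:
  assumes "finite J" "J \<noteq> {}" and "f \<in> borel_measurable borel"
  shows "(\<integral>\<^sup>+y. f (\<Sum>k\<in>J. (norm (y k))\<^sup>2) \<partial>PiM J (\<lambda>_. gauss :: 'a::euclidean_space measure)) =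
    (\<integral>\<^sup>+t. f t \<partial>gamma_distr (real (card J) * (DIM('a) / 2)))"
  using assms
proof (induction J arbitrary: f rule: finite_ne_induct)
  case (singleton i)
  have [measurable]: "f \<in> borel_measurable borel" by fact
  have "(\<integral>\<^sup>+y. f (\<Sum>k\<in>{i}. (norm (y k))\<^sup>2) \<partial>PiM {i} (\<lambda>_. gauss :: 'a measure)) = 
    (\<integral>\<^sup>+y. (\<lambda>z. f ((norm z)\<^sup>2)) (y i) \<partial>PiM {i} (\<lambda>_. gauss :: 'a measure))" by simp
  also have "\<dots> = (\<integral>\<^sup>+z. f ((norm z)\<^sup>2) \<partial>(gauss :: 'a measure))"
    by (rule product_sigma_finite.product_nn_integral_singleton[OF product_sigma_finite_gauss, where f="\<lambda>z. f ((norm z)\<^sup>2)"]) measurable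
  finally show ?case by (simp add: nn_integral_gauss_norm singleton)
next
  case (insert i J)
  have f[measurable]: "f \<in> borel_measurable borel" by fact
  let ?b = "real (card J) * (DIM('a) / 2)"
  have b: "?b > 0" using insert.hyps by (auto simp: card_gt_0_iff)
  interpret g: sigma_finite_measure "gamma_distr ?b" by (rule sigma_finite_gamma_distr[OF b])
  have "(\<integral>\<^sup>+y. f (\<Sum>k\<in>insert i J. (norm (y k))\<^sup>2) \<partial>PiM (insert i J) (\<lambda>_. gauss :: 'a measure)) =
    (\<integral>\<^sup>+z. \<integral>\<^sup>+y. f (\<Sum>k\<in>insert i J. (norm ((y(i := z)) k))\<^sup>2) \<partial>PiM J (\<lambda>_. gauss) \<partial>(gauss :: 'a measure))"
    using insert.hyps by (intro nn_integral_PiM_gauss_insert) auto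
  also have "\<dots> = (\<integral>\<^sup>+z. \<integral>\<^sup>+y. f ((norm z)\<^sup>2 + (\<Sum>k\<in>J. (norm (y k))\<^sup>2)) \<partial>PiM J (\<lambda>_. gauss :: 'a measure) \<partial>(gauss :: 'a measure))"
    using insert.hyps by (simp only: sum_fun_upd_insert[OF \<open>finite J\<close> \<open>i \<notin> J\<close>, where g="\<lambda>k z. (norm z)\<^sup>2"])
  also have "\<dots> = (\<integral>\<^sup>+z. \<integral>\<^sup>+t. f ((norm z)\<^sup>2 + t) \<partial>gamma_distr ?b \<partial>(gauss :: 'a measure))"
    by (intro nn_integral_cong insert.IH) measurable
  also have "\<dots> = (\<integral>\<^sup>+s. \<integral>\<^sup>+t. f (s + t) \<partial>gamma_distr ?b \<partial>gamma_distr (DIM('a) / 2))"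
    by (intro nn_integral_gauss_norm) measurable
  also have "\<dots> = (\<integral>\<^sup>+t. f t \<partial>gamma_distr (DIM('a) / 2 + ?b))"
    by (intro nn_integral_gamma_distr_add b f) simp
  also have "DIM('a) / 2 + ?b = real (card (insert i J)) * (DIM('a) / 2)"
    using insert.hyps by (simp add: field_simps)
  finally show ?case .
qed

lemma nn_integral_PiM_gauss_const:
  assumes "finite J"
  shows "(\<integral>\<^sup>+y. c \<partial>PiM J (\<lambda>_. gauss :: 'a::euclidean_space measure)) = c"
proof (cases "J = {}")
  case True
  then show ?thesis by (simp add: space_PiM product_sigma_finite.nn_integral_empty[OF product_sigma_finite_gauss])
next
  case False
  then have "real (card J) * (DIM('a) / 2) > 0" using assms by (simp add: card_gt_0_iff)
  then show ?thesis
    using nn_integral_PiM_gauss_norm[OF assms False, of "\<lambda>_. c", where 'a='a] by (simp add: emeasure_gamma_distr)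
qed

context conj_field

\<comment> \<open>Linear forms and weighted squares of a Gaussian vector\<close>
begin

text \<open>Dividing by the norm of (a, \<open>\<rho>\<close>) reduces this to the rotation lemma.
  The second coefficient is real because it is the norm accumulated from the coordinates already
  merged in the induction that follows.\<close>

lemma nn_integral_gauss_combine:
  fixes a :: 'a and \<rho> :: real
  assumes f[measurable]: "f \<in> borel_measurable borel"
  shows "(\<integral>\<^sup>+z. \<integral>\<^sup>+w. f (a * z + of_real \<rho> * w) \<partial>gauss \<partial>gauss) =
    (\<integral>\<^sup>+z. f (of_real (sqrt ((norm a)\<^sup>2 + \<rho>\<^sup>2)) * z) \<partial>gauss)"
proof -
  define c where "c = sqrt ((norm a)\<^sup>2 + \<rho>\<^sup>2)"
  show ?thesis
  proof (cases "c = 0")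
    case True
    then have "(norm a)\<^sup>2 + \<rho>\<^sup>2 = 0" unfolding c_def by simp
    then have "a = 0 \<and> \<rho> = 0" by (simp add: sum_power2_eq_zero_iff)
    then show ?thesis by (simp add: emeasure_gauss)
  next
    case False
    then have c: "c > 0" unfolding c_def by (simp add: less_le)
    have c2: "c\<^sup>2 = (norm a)\<^sup>2 + \<rho>\<^sup>2" unfolding c_def by simp
    have 1: "(norm (a / of_real c))\<^sup>2 + (norm (of_real (\<rho> / c) :: 'a))\<^sup>2 = 1"
    proof -
      have "(norm a)\<^sup>2 / c\<^sup>2 + \<rho>\<^sup>2 / c\<^sup>2 = 1"
        using c unfolding add_divide_distrib[symmetric] c2[symmetric] by simp
      then show ?thesis using c by (simp add: norm_divide power_divide)
    qed
    have [measurable]: "(\<lambda>z. f (of_real c * z)) \<in> borel_measurable borel" by measurable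
    have "of_real c * (a / of_real c * z + of_real (\<rho> / c) * w) = a * z + of_real \<rho> * w" for z w
      using c by (simp add: field_simps)
    with nn_integral_gauss_rotate[OF 1, of "\<lambda>z. f (of_real c * z)"] show ?thesis
      by (simp add: c_def[symmetric])
  qed
qed

lemma nn_integral_PiM_gauss_linear:
  fixes w :: "'i \<Rightarrow> 'a"
  assumes "finite J" and "f \<in> borel_measurable borel"
  shows "(\<integral>\<^sup>+y. f (\<Sum>k\<in>J. w k * y k) \<partial>PiM J (\<lambda>_. gauss)) =
    (\<integral>\<^sup>+z. f (of_real (sqrt (\<Sum>k\<in>J. (norm (w k))\<^sup>2)) * z) \<partial>gauss)"
  using assms
proof (induction J arbitrary: f rule: finite_induct)
  case empty
  then show ?case
    by (simp add: space_PiM emeasure_gauss product_sigma_finite.nn_integral_empty[OF product_sigma_finite_gauss])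
next
  case (insert i J)
  have f[measurable]: "f \<in> borel_measurable borel" by fact
  let ?r = "sqrt (\<Sum>k\<in>J. (norm (w k))\<^sup>2)"
  have "(\<integral>\<^sup>+y. f (\<Sum>k\<in>insert i J. w k * y k) \<partial>PiM (insert i J) (\<lambda>_. gauss)) =
    (\<integral>\<^sup>+z. \<integral>\<^sup>+y. f (\<Sum>k\<in>insert i J. w k * (y(i := z)) k) \<partial>PiM J (\<lambda>_. gauss) \<partial>gauss)"
    using insert.hyps by (intro nn_integral_PiM_gauss_insert) auto
  also have "\<dots> = (\<integral>\<^sup>+z. \<integral>\<^sup>+y. f (w i * z + (\<Sum>k\<in>J. w k * y k)) \<partial>PiM J (\<lambda>_. gauss) \<partial>gauss)"
    using insert.hyps by (simp only: sum_fun_upd_insert[OF \<open>finite J\<close> \<open>i \<notin> J\<close>, where g="\<lambda>k z. w k * z"])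
  also have "\<dots> = (\<integral>\<^sup>+z. \<integral>\<^sup>+z'. f (w i * z + of_real ?r * z') \<partial>gauss \<partial>gauss)"
    by (intro nn_integral_cong insert.IH) measurable
  also have "\<dots> = (\<integral>\<^sup>+z. f (of_real (sqrt ((norm (w i))\<^sup>2 + ?r\<^sup>2)) * z) \<partial>gauss)"
    by (rule nn_integral_gauss_combine[OF f])
  also have "(norm (w i))\<^sup>2 + ?r\<^sup>2 = (\<Sum>k\<in>insert i J. (norm (w k))\<^sup>2)"
    using insert.hyps by (simp add: sum_nonneg)
  finally show ?case .
qed

lemma nn_integral_gauss_uminus:
  assumes [measurable]: "f \<in> borel_measurable borel"
  shows "(\<integral>\<^sup>+z. f (- z) \<partial>(gauss :: 'a measure)) = (\<integral>\<^sup>+z. f z \<partial>gauss)"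
  using nn_integral_gauss_rotate[of "-1" 0 f] by (simp add: emeasure_gauss)

text \<open>The weight \<open>\<phi>\<close> sees only the norms of the coordinates, so reflecting
  one coordinate leaves it unchanged, and averaging over the reflection removes the cross terms by
  the parallelogram identity. \<open>v\<close> and \<open>c\<close> make the induction go through:
  they hold the contribution of the coordinates already split off to the linear form and to the
  squared norm.\<close>

lemma nn_integral_PiM_gauss_square:
  fixes w :: "'i \<Rightarrow> 'a" and \<phi> :: "real \<Rightarrow> ennreal"
  assumes "finite J" and \<phi>[measurable]: "\<phi> \<in> borel_measurable borel"
  shows "(\<integral>\<^sup>+y. ennreal ((norm (v + (\<Sum>k\<in>J. w k * y k)))\<^sup>2) * \<phi> (c + (\<Sum>k\<in>J. (norm (y k))\<^sup>2)) \<partial>PiM J (\<lambda>_. gauss)) =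
    (\<integral>\<^sup>+y. ennreal ((norm v)\<^sup>2 + (\<Sum>k\<in>J. (norm (w k * y k))\<^sup>2)) * \<phi> (c + (\<Sum>k\<in>J. (norm (y k))\<^sup>2)) \<partial>PiM J (\<lambda>_. gauss))"
  using assms(1)
proof (induction J arbitrary: v c rule: finite_induct)
  case (insert i J)
  interpret gp: sigma_finite_measure "PiM J (\<lambda>_. gauss :: 'a measure)"
    by (intro product_sigma_finite.sigma_finite product_sigma_finite_gauss insert)
  let ?S = "\<lambda>y. \<Sum>k\<in>J. (norm (w k * y k))\<^sup>2" and ?T = "\<lambda>y. \<Sum>k\<in>J. (norm (y k))\<^sup>2"
  define H where "H u z = (\<integral>\<^sup>+y. ennreal (u + ?S y) * \<phi> (c + (norm z)\<^sup>2 + ?T y) \<partial>PiM J (\<lambda>_. gauss))" for u :: real and z :: 'a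
  define G where "G z = H ((norm (v + w i * z))\<^sup>2) z" for z
  have G[measurable]: "G \<in> borel_measurable borel" unfolding G_def H_def by measurable
  have par: "(norm (v + w i * z))\<^sup>2 + (norm (v + w i * (- z)))\<^sup>2 = 2 * ((norm v)\<^sup>2 + (norm (w i * z))\<^sup>2)" for z
    using parallelogram_identity[of v "w i * z"] by simp
  have GG: "G z + G (- z) = 2 * H ((norm v)\<^sup>2 + (norm (w i * z))\<^sup>2) z" for z
  proof -
    have "G z + G (- z) = (\<integral>\<^sup>+y. ennreal ((norm (v + w i * z))\<^sup>2 + ?S y) * \<phi> (c + (norm z)\<^sup>2 + ?T y) + 
       ennreal ((norm (v + w i * (- z)))\<^sup>2 + ?S y) * \<phi> (c + (norm z)\<^sup>2 + ?T y) \<partial>PiM J (\<lambda>_. gauss))"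
      unfolding G_def H_def norm_minus_cancel by (subst nn_integral_add) auto
    also have "\<dots> = (\<integral>\<^sup>+y. 2 * (ennreal ((norm v)\<^sup>2 + (norm (w i * z))\<^sup>2 + ?S y) * \<phi> (c + (norm z)\<^sup>2 + ?T y)) \<partial>PiM J (\<lambda>_. gauss))"
    proof (rule nn_integral_cong)
      fix y
      have S: "?S y \<ge> 0" by (simp add: sum_nonneg)
      have "ennreal ((norm (v + w i * z))\<^sup>2 + ?S y) + ennreal ((norm (v + w i * (- z)))\<^sup>2 + ?S y)
        = ennreal (2 * ((norm v)\<^sup>2 + (norm (w i * z))\<^sup>2 + ?S y))"
        using S par[of z] by (subst ennreal_plus[symmetric]) auto
      also have "\<dots> = 2 * ennreal ((norm v)\<^sup>2 + (norm (w i * z))\<^sup>2 + ?S y)"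
        using S by (subst ennreal_mult) auto
      finally show "ennreal ((norm (v + w i * z))\<^sup>2 + ?S y) * \<phi> (c + (norm z)\<^sup>2 + ?T y) + 
       ennreal ((norm (v + w i * (- z)))\<^sup>2 + ?S y) * \<phi> (c + (norm z)\<^sup>2 + ?T y) = 
        2 * (ennreal ((norm v)\<^sup>2 + (norm (w i * z))\<^sup>2 + ?S y) * \<phi> (c + (norm z)\<^sup>2 + ?T y))"
        by (simp add: distrib_right[symmetric] mult.assoc[symmetric])
    qed
    also have "\<dots> = 2 * H ((norm v)\<^sup>2 + (norm (w i * z))\<^sup>2) z"
      unfolding H_def by (intro nn_integral_cmult) measurable
    finally show ?thesis .
  qed
  have "(\<integral>\<^sup>+y. ennreal ((norm (v + (\<Sum>k\<in>insert i J. w k * y k)))\<^sup>2) * \<phi> (c + (\<Sum>k\<in>insert i J. (norm (y k))\<^sup>2)) \<partial>PiM (insert i J) (\<lambda>_. gauss))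
    = (\<integral>\<^sup>+z. \<integral>\<^sup>+y. ennreal ((norm (v + (\<Sum>k\<in>insert i J. w k * (y(i:=z)) k)))\<^sup>2) * \<phi> (c + (\<Sum>k\<in>insert i J. (norm ((y(i:=z)) k))\<^sup>2)) \<partial>PiM J (\<lambda>_. gauss) \<partial>gauss)"
    using insert.hyps by (intro nn_integral_PiM_gauss_insert) auto
  also have "\<dots> = (\<integral>\<^sup>+z. \<integral>\<^sup>+y. ennreal ((norm (v + w i * z + (\<Sum>k\<in>J. w k * y k)))\<^sup>2) * \<phi> (c + (norm z)\<^sup>2 + ?T y) \<partial>PiM J (\<lambda>_. gauss) \<partial>gauss)"
    using insert.hyps by (simp only: sum_fun_upd_insert[OF \<open>finite J\<close> \<open>i \<notin> J\<close>, where g="\<lambda>k z. w k * z"] sum_fun_upd_insert[OF \<open>finite J\<close> \<open>i \<notin> J\<close>, where g="\<lambda>k z. (norm z)\<^sup>2"] add.assoc)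
  also have "\<dots> = (\<integral>\<^sup>+z. G z \<partial>gauss)"
    unfolding insert.IH G_def H_def ..
  finally have L: "(\<integral>\<^sup>+y. ennreal ((norm (v + (\<Sum>k\<in>insert i J. w k * y k)))\<^sup>2) * \<phi> (c + (\<Sum>k\<in>insert i J. (norm (y k))\<^sup>2)) \<partial>PiM (insert i J) (\<lambda>_. gauss)) = (\<integral>\<^sup>+z. G z \<partial>gauss)" .
  \<comment> \<open>Adding the reflected copy and cancelling the factor 2 avoids the signed cross
    terms, which a nonnegative integral could not express.\<close>
  have "2 * (\<integral>\<^sup>+z. G z \<partial>gauss) = (\<integral>\<^sup>+z. G z \<partial>gauss) + (\<integral>\<^sup>+z. G (- z) \<partial>gauss)"
    by (simp add: nn_integral_gauss_uminus mult_2)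
  also have "\<dots> = (\<integral>\<^sup>+z. G z + G (- z) \<partial>gauss)"
    by (intro nn_integral_add[symmetric]) measurable
  also have "\<dots> = 2 * (\<integral>\<^sup>+z. H ((norm v)\<^sup>2 + (norm (w i * z))\<^sup>2) z \<partial>gauss)"
    unfolding GG H_def by (intro nn_integral_cmult) measurable
  finally have "(\<integral>\<^sup>+z. G z \<partial>gauss) = (\<integral>\<^sup>+z. H ((norm v)\<^sup>2 + (norm (w i * z))\<^sup>2) z \<partial>gauss)"
    by (simp add: ennreal_mult_cancel_left)
  also have "\<dots> = (\<integral>\<^sup>+z. \<integral>\<^sup>+y. ennreal ((norm v)\<^sup>2 + (\<Sum>k\<in>insert i J. (norm (w k * (y(i:=z)) k))\<^sup>2)) * \<phi> (c + (\<Sum>k\<in>insert i J. (norm ((y(i:=z)) k))\<^sup>2)) \<partial>PiM J (\<lambda>_. gauss) \<partial>gauss)"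
    unfolding H_def using insert.hyps by (simp only: sum_fun_upd_insert[OF \<open>finite J\<close> \<open>i \<notin> J\<close>, where g="\<lambda>k z. (norm (w k * z))\<^sup>2"] sum_fun_upd_insert[OF \<open>finite J\<close> \<open>i \<notin> J\<close>, where g="\<lambda>k z. (norm z)\<^sup>2"] add.assoc)
  also have "\<dots> = (\<integral>\<^sup>+y. ennreal ((norm v)\<^sup>2 + (\<Sum>k\<in>insert i J. (norm (w k * y k))\<^sup>2)) * \<phi> (c + (\<Sum>k\<in>insert i J. (norm (y k))\<^sup>2)) \<partial>PiM (insert i J) (\<lambda>_. gauss))"
    using insert.hyps by (intro nn_integral_PiM_gauss_insert[symmetric]) auto
  finally show ?case unfolding L .
qed simp

text \<open>After removal of the cross terms the integral is a combination of the means
  \<open>A k\<close> of |y k|^2 / |y|^2. These are equal by symmetry and add up to at most 1, so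
  each is at most 1 / card J.\<close>

lemma nn_integral_PiM_gauss_ratio:
  fixes w :: "'i \<Rightarrow> 'a"
  assumes J: "finite J"
  shows "(\<integral>\<^sup>+y. ennreal ((norm (\<Sum>k\<in>J. w k * y k))\<^sup>2 / (\<Sum>k\<in>J. (norm (y k))\<^sup>2)) \<partial>PiM J (\<lambda>_. gauss))
    \<le> ennreal ((\<Sum>k\<in>J. (norm (w k))\<^sup>2) / real (card J))"
proof -
  define \<phi> :: "real \<Rightarrow> ennreal" where "\<phi> t = ennreal (inverse t)" for t
  have \<phi>[measurable]: "\<phi> \<in> borel_measurable borel" unfolding \<phi>_def by measurable
  let ?T = "\<lambda>y. \<Sum>k\<in>J. (norm (y k :: 'a))\<^sup>2"
  have T: "?T y \<ge> 0" for y by (simp add: sum_nonneg)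
  define A where "A k = (\<integral>\<^sup>+y. ennreal ((norm (y k))\<^sup>2) * \<phi> (?T y) \<partial>PiM J (\<lambda>_. gauss :: 'a measure))" for k
  \<comment> \<open>The right-hand side mentions \<open>k\<close> no more, only the cardinality of
    \<open>J\<close>. This yields the symmetry between coordinates without permuting the product
    measure.\<close>
  have A_eq: "A k = (\<integral>\<^sup>+z. \<integral>\<^sup>+t. ennreal ((norm z)\<^sup>2) * \<phi> ((norm z)\<^sup>2 + t) \<partial>gamma_distr (real (card J - 1) * (DIM('a) / 2)) \<partial>(gauss :: 'a measure))"
    if k: "k \<in> J" and J1: "J - {k} \<noteq> {}" for k
  proof -
    have ins: "insert k (J - {k}) = J" using k by auto
    have "A k = (\<integral>\<^sup>+z. \<integral>\<^sup>+y. ennreal ((norm ((y(k:=z)) k))\<^sup>2) * \<phi> (?T (y(k:=z))) \<partial>PiM (J - {k}) (\<lambda>_. gauss) \<partial>(gauss :: 'a measure))"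
    proof -
      have "(\<lambda>y. ennreal ((norm (y k))\<^sup>2) * \<phi> (?T y)) \<in> borel_measurable (PiM J (\<lambda>_. gauss :: 'a measure))"
        using k by measurable
      then show ?thesis
        unfolding A_def
        using J nn_integral_PiM_gauss_insert[of "J - {k}" k "\<lambda>y. ennreal ((norm (y k))\<^sup>2) * \<phi> (?T y)", unfolded ins]
        by simp
    qed
    also have "\<dots> = (\<integral>\<^sup>+z. \<integral>\<^sup>+y. ennreal ((norm z)\<^sup>2) * \<phi> ((norm z)\<^sup>2 + (\<Sum>j\<in>J - {k}. (norm (y j))\<^sup>2)) \<partial>PiM (J - {k}) (\<lambda>_. gauss :: 'a measure) \<partial>(gauss :: 'a measure))"
    proof -
      have T_upd: "?T (y(k:=z)) = (norm z)\<^sup>2 + (\<Sum>j\<in>J - {k}. (norm (y j))\<^sup>2)" for y and z :: 'a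
        using sum_fun_upd_insert[of "J - {k}" k "\<lambda>k z. (norm z)\<^sup>2" y z] J ins by simp
      show ?thesis unfolding T_upd by simp
    qed
    also have "\<dots> = (\<integral>\<^sup>+z. \<integral>\<^sup>+t. ennreal ((norm z)\<^sup>2) * \<phi> ((norm z)\<^sup>2 + t) \<partial>gamma_distr (real (card (J - {k})) * (DIM('a) / 2)) \<partial>(gauss :: 'a measure))"
    proof (rule nn_integral_cong)
      fix z :: 'a
      have m: "(\<lambda>t. ennreal ((norm z)\<^sup>2) * \<phi> ((norm z)\<^sup>2 + t)) \<in> borel_measurable borel" by measurable
      show "(\<integral>\<^sup>+y. ennreal ((norm z)\<^sup>2) * \<phi> ((norm z)\<^sup>2 + (\<Sum>j\<in>J - {k}. (norm (y j))\<^sup>2)) \<partial>PiM (J - {k}) (\<lambda>_. gauss :: 'a measure)) =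
        (\<integral>\<^sup>+t. ennreal ((norm z)\<^sup>2) * \<phi> ((norm z)\<^sup>2 + t) \<partial>gamma_distr (real (card (J - {k})) * (DIM('a) / 2)))"
        using nn_integral_PiM_gauss_norm[OF _ J1 m, where 'a='a] J by simp
    qed
    also have "card (J - {k}) = card J - 1" using k J by simp
    finally show ?thesis .
  qed
  have A_const: "A k = A l" if "k \<in> J" "l \<in> J" for k l
  proof (cases "k = l")
    case False
    then have "J - {k} \<noteq> {}" "J - {l} \<noteq> {}" using that by auto
    from A_eq[OF that(1) this(1)] A_eq[OF that(2) this(2)] show ?thesis by (rule trans[OF _ sym])
  qed simp
  have "(\<Sum>k\<in>J. A k) = (\<integral>\<^sup>+y. (\<Sum>k\<in>J. ennreal ((norm (y k))\<^sup>2) * \<phi> (?T y)) \<partial>PiM J (\<lambda>_. gauss :: 'a measure))"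
    unfolding A_def by (intro nn_integral_sum[symmetric]) measurable
  also have "\<dots> \<le> (\<integral>\<^sup>+y. 1 \<partial>PiM J (\<lambda>_. gauss :: 'a measure))"
  proof (intro nn_integral_mono)
    fix y :: "'i \<Rightarrow> 'a"
    have "(\<Sum>k\<in>J. ennreal ((norm (y k))\<^sup>2) * \<phi> (?T y)) = ennreal (?T y) * \<phi> (?T y)"
      by (simp add: sum_distrib_right[symmetric])
    also have "\<dots> = ennreal (?T y * inverse (?T y))"
      unfolding \<phi>_def using T by (intro ennreal_mult[symmetric]) auto
    \<comment> \<open>An inequality only, as the product is 0 instead of 1 when y vanishes on
      \<open>J\<close>.\<close>
    also have "\<dots> \<le> ennreal 1" by (intro ennreal_leI) (cases "?T y = 0", auto)
    finally show "(\<Sum>k\<in>J. ennreal ((norm (y k))\<^sup>2) * \<phi> (?T y)) \<le> 1" by simp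
  qed
  also have "\<dots> = 1" using J by (rule nn_integral_PiM_gauss_const)
  finally have sumA: "(\<Sum>k\<in>J. A k) \<le> 1" .
  have Ale: "A k \<le> ennreal (1 / real (card J))" if k: "k \<in> J" for k
  proof -
    have c: "card J > 0" using k J by (auto simp: card_gt_0_iff)
    have "(\<Sum>l\<in>J. A l) = (\<Sum>l\<in>J. A k)" by (rule sum.cong[OF refl]) (rule A_const[OF _ k])
    then have le: "ennreal (real (card J)) * A k \<le> 1" using sumA by (simp add: ennreal_of_nat_eq_real_of_nat)
    have "A k = ennreal (1 / real (card J)) * (ennreal (real (card J)) * A k)"
      using c by (simp add: mult.assoc[symmetric] ennreal_mult'[symmetric])
    also have "\<dots> \<le> ennreal (1 / real (card J)) * 1" by (intro mult_left_mono le) simp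
    finally show ?thesis by simp
  qed
  have "(\<integral>\<^sup>+y. ennreal ((norm (\<Sum>k\<in>J. w k * y k))\<^sup>2 / ?T y) \<partial>PiM J (\<lambda>_. gauss)) =
     (\<integral>\<^sup>+y. ennreal ((norm (0 + (\<Sum>k\<in>J. w k * y k)))\<^sup>2) * \<phi> (0 + ?T y) \<partial>PiM J (\<lambda>_. gauss))"
    unfolding \<phi>_def using T by (intro nn_integral_cong) (simp add: divide_inverse ennreal_mult)
  also have "\<dots> = (\<integral>\<^sup>+y. ennreal ((norm (0::'a))\<^sup>2 + (\<Sum>k\<in>J. (norm (w k * y k))\<^sup>2)) * \<phi> (0 + ?T y) \<partial>PiM J (\<lambda>_. gauss))"
    by (rule nn_integral_PiM_gauss_square[OF J \<phi>])
  also have "\<dots> = (\<integral>\<^sup>+y. (\<Sum>k\<in>J. ennreal ((norm (w k))\<^sup>2) * (ennreal ((norm (y k))\<^sup>2) * \<phi> (?T y))) \<partial>PiM J (\<lambda>_. gauss))"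
    by (intro nn_integral_cong)
      (simp add: norm_mult power_mult_distrib sum_ennreal[symmetric] ennreal_mult sum_distrib_right mult.assoc del: sum_ennreal)
  also have "\<dots> = (\<Sum>k\<in>J. ennreal ((norm (w k))\<^sup>2) * A k)"
    unfolding A_def by (subst nn_integral_sum, measurable, intro sum.cong refl nn_integral_cmult) measurable
  also have "\<dots> \<le> (\<Sum>k\<in>J. ennreal ((norm (w k))\<^sup>2) * ennreal (1 / real (card J)))"
    by (intro sum_mono mult_left_mono Ale) auto
  also have "\<dots> = ennreal ((\<Sum>k\<in>J. (norm (w k))\<^sup>2) / real (card J))"
    by (simp add: ennreal_mult[symmetric] sum_divide_distrib)
  finally show ?thesis .
qed

end

section \<open>The logarithmic moment bound\<close>

lemma pos_not_nonpos_Ints: "(x::real) > 0 \<Longrightarrow> x \<notin> \<int>\<^sub>\<le>\<^sub>0"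
  using nonpos_Ints_nonpos[of x] by linarith

text \<open>The difference quotient at s = 0 of Gamma (x + c s) / Gamma x, whose derivative is c
  times the logarithmic derivative of Gamma. Here the moments turn into digamma values.\<close>

lemma tendsto_Gamma_quotient:
  assumes x: "(x::real) > 0"
  shows "((\<lambda>s. (Gamma (x + c * s) / Gamma x - 1) / s) \<longlongrightarrow> c * Digamma x) (at_right 0)"
proof -
  have G: "Gamma x > 0" using x by (rule Gamma_real_pos)
  have "((\<lambda>s. Gamma (x + c * s) / Gamma x) has_field_derivative c * Digamma x) (at 0)"
    using G pos_not_nonpos_Ints[OF x] by (auto intro!: derivative_eq_intros)
  then have "((\<lambda>s. (Gamma (x + c * s) / Gamma x - 1) / s) \<longlongrightarrow> c * Digamma x) (at 0)"
    using G by (simp add: DERIV_def)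
  then show ?thesis by (rule tendsto_within_subset[where S=UNIV]) simp
qed

text \<open>\<open>powr\<close> takes the value 0 at base 0. The integrand is set to infinity there
  instead, at no cost on a null set, so that a finite value at a sample point later certifies that
  the base is nonzero.\<close>

lemma nn_integral_gamma_distr_neg_powr:
  assumes "a > 0" "a - s > 0"
  shows "(\<integral>\<^sup>+t. (if t = 0 then \<infinity> else ennreal (t powr (- s))) \<partial>gamma_distr a) = ennreal (Gamma (a - s) / Gamma a)"
proof -
  have "AE t in gamma_distr a. t \<noteq> 0"
    unfolding gamma_distr_def using AE_lborel_singleton[of "0::real"] by (subst AE_density) auto
  then have "(\<integral>\<^sup>+t. (if t = 0 then \<infinity> else ennreal (t powr (- s))) \<partial>gamma_distr a) =
      (\<integral>\<^sup>+t. ennreal (t powr (- s)) \<partial>gamma_distr a)"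
    by (intro nn_integral_cong_AE) auto
  then show ?thesis using nn_integral_gamma_distr_powr[of a "- s"] assms by simp
qed

section \<open>Choosing one sample that is good for all forms at once\<close>

context conj_field
begin

text \<open>Under the product Gaussian the three summands have means equal to the two Gamma
  quotients and at most s. A nonnegative function on a probability space cannot exceed a bound on
  its mean everywhere by a fixed positive amount.\<close>

lemma exists_moment_bound:
  fixes W :: "'p \<Rightarrow> 'i \<Rightarrow> 'a" and V :: "'q \<Rightarrow> 'i \<Rightarrow> 'a" and \<alpha> :: real
  defines "\<alpha> \<equiv> DIM('a) / 2"
  assumes J: "finite J" "J \<noteq> {}" and s: "0 < s" "s < \<alpha>"
    and I: "finite I" and c: "\<And>p. p \<in> I \<Longrightarrow> c p > 0" "(\<Sum>p\<in>I. c p) = 1"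
    and W: "\<And>p. p \<in> I \<Longrightarrow> (\<Sum>k\<in>J. (norm (W p k))\<^sup>2) = 1"
    and L: "finite L" and V: "(\<Sum>q\<in>L. \<Sum>k\<in>J. (norm (V q k))\<^sup>2) = 1"
  obtains y where "\<And>p. p \<in> I \<Longrightarrow> (\<Sum>k\<in>J. W p k * y k) \<noteq> 0"
    and "(\<Sum>p\<in>I. c p * ((norm (\<Sum>k\<in>J. W p k * y k))\<^sup>2) powr (- s)) + (\<Sum>k\<in>J. (norm (y k))\<^sup>2) powr s
      + s * (real (card J) * ((\<Sum>q\<in>L. (norm (\<Sum>k\<in>J. V q k * y k))\<^sup>2) / (\<Sum>k\<in>J. (norm (y k))\<^sup>2)))
      \<le> Gamma (\<alpha> - s) / Gamma \<alpha> + Gamma (card J * \<alpha> + s) / Gamma (card J * \<alpha>) + s + s\<^sup>2"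
proof -
  let ?M = "PiM J (\<lambda>_. gauss :: 'a measure)"
  let ?T = "\<lambda>y. \<Sum>k\<in>J. (norm (y k :: 'a))\<^sup>2"
  let ?r = "real (card J)"
  let ?m = "Gamma (\<alpha> - s) / Gamma \<alpha>" and ?n = "Gamma (?r * \<alpha> + s) / Gamma (?r * \<alpha>)"
  have r: "?r > 0" using J by (simp add: card_gt_0_iff)
  have \<alpha>: "\<alpha> > 0" unfolding \<alpha>_def by simp
  have m: "?m \<ge> 0" and n: "?n \<ge> 0"
    using \<alpha> s r mult_pos_pos[OF r \<alpha>] add_pos_pos[OF mult_pos_pos[OF r \<alpha>] s(1)] by (auto intro!: divide_nonneg_nonneg Gamma_real_nonneg)
  define \<psi> :: "real \<Rightarrow> ennreal" where "\<psi> t = (if t = 0 then \<infinity> else ennreal (t powr (- s)))" for t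
  have [measurable]: "\<psi> \<in> borel_measurable borel" unfolding \<psi>_def by (rule measurable_If) auto
  define lw where "lw p y = (norm (\<Sum>k\<in>J. W p k * y k))\<^sup>2" for p y
  define lv where "lv q y = (norm (\<Sum>k\<in>J. V q k * y k))\<^sup>2" for q y
  have [measurable]: "lw p \<in> borel_measurable ?M" "lv q \<in> borel_measurable ?M" for p q
    unfolding lw_def lv_def by measurable
  define H where "H y = (\<Sum>p\<in>I. ennreal (c p) * \<psi> (lw p y)) + ennreal (?T y powr s) 
    + (\<Sum>q\<in>L. ennreal (s * ?r) * ennreal (lv q y / ?T y))" for y
  have [measurable]: "H \<in> borel_measurable ?M" unfolding H_def by measurable
  have Iw: "(\<integral>\<^sup>+y. \<psi> (lw p y) \<partial>?M) = ennreal ?m" if p: "p \<in> I" for p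
  proof -
    have "(\<integral>\<^sup>+y. \<psi> (lw p y) \<partial>?M) = (\<integral>\<^sup>+z. \<psi> ((norm z)\<^sup>2) \<partial>(gauss :: 'a measure))"
      unfolding lw_def by (subst nn_integral_PiM_gauss_linear[OF J(1), where f="\<lambda>z. \<psi> ((norm z)\<^sup>2)"])
        (use W[OF p] in auto)
    also have "\<dots> = ennreal ?m"
      using s \<alpha> nn_integral_gamma_distr_neg_powr[of \<alpha> s, folded \<psi>_def]
      by (subst nn_integral_gauss_norm) (auto simp: \<alpha>_def)
    finally show ?thesis .
  qed
  have IT: "(\<integral>\<^sup>+y. ennreal (?T y powr s) \<partial>?M) = ennreal ?n"
    using nn_integral_PiM_gauss_norm[OF J, of "\<lambda>t. ennreal (t powr s)", where 'a='a]
      nn_integral_gamma_distr_powr[OF mult_pos_pos[OF r \<alpha>] add_pos_pos[OF mult_pos_pos[OF r \<alpha>] s(1)]]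
    by (simp add: \<alpha>_def)
  have Iv: "(\<integral>\<^sup>+y. ennreal (lv q y / ?T y) \<partial>?M) \<le> ennreal ((\<Sum>k\<in>J. (norm (V q k))\<^sup>2) / ?r)" for q
    unfolding lv_def by (rule nn_integral_PiM_gauss_ratio[OF J(1)])
  have "(\<integral>\<^sup>+y. H y \<partial>?M) = (\<Sum>p\<in>I. ennreal (c p) * (\<integral>\<^sup>+y. \<psi> (lw p y) \<partial>?M)) + (\<integral>\<^sup>+y. ennreal (?T y powr s) \<partial>?M)
    + (\<Sum>q\<in>L. ennreal (s * ?r) * (\<integral>\<^sup>+y. ennreal (lv q y / ?T y) \<partial>?M))"
    unfolding H_def by (simp add: nn_integral_add nn_integral_sum nn_integral_cmult)
  also have "\<dots> \<le> (\<Sum>p\<in>I. ennreal (c p) * ennreal ?m) + ennreal ?n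
    + (\<Sum>q\<in>L. ennreal (s * ?r) * ennreal ((\<Sum>k\<in>J. (norm (V q k))\<^sup>2) / ?r))"
    unfolding IT by (intro add_mono sum_mono mult_left_mono Iv order.refl) (simp_all add: Iw)
  also have "(\<Sum>p\<in>I. ennreal (c p) * ennreal ?m) = ennreal ?m"
    using c m by (simp add: sum_distrib_right[symmetric] less_imp_le)
  also have "(\<Sum>q\<in>L. ennreal (s * ?r) * ennreal ((\<Sum>k\<in>J. (norm (V q k))\<^sup>2) / ?r)) = 
      (\<Sum>q\<in>L. ennreal (s * (\<Sum>k\<in>J. (norm (V q k))\<^sup>2)))"
    using r s by (intro sum.cong refl) (simp add: ennreal_mult[symmetric] sum_nonneg)
  also have "\<dots> = ennreal s"
    using V s by (simp add: sum_nonneg sum_distrib_left[symmetric])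
  finally have HI: "(\<integral>\<^sup>+y. H y \<partial>?M) \<le> ennreal (?m + ?n + s)"
    using m n s by (simp add: ennreal_plus)
  \<comment> \<open>The slack s^2 makes the contradiction strict, and being of smaller order than s
    it disappears in the limit after division by s.\<close>
  have "\<exists>y. H y \<le> ennreal (?m + ?n + s + s\<^sup>2)"
  proof (rule ccontr)
    assume "\<not> ?thesis"
    then have "(\<integral>\<^sup>+y. ennreal (?m + ?n + s + s\<^sup>2) \<partial>?M) \<le> (\<integral>\<^sup>+y. H y \<partial>?M)"
      by (intro nn_integral_mono) (auto simp: not_le less_imp_le)
    with HI have "ennreal (?m + ?n + s + s\<^sup>2) \<le> ennreal (?m + ?n + s)"
      by (simp add: nn_integral_PiM_gauss_const[OF J(1)] del: nn_integral_const)
    then show False using m n s by (subst (asm) ennreal_le_iff) auto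
  qed
  then obtain y where y: "H y \<le> ennreal (?m + ?n + s + s\<^sup>2)" by blast
  have nz: "lw p y \<noteq> 0" if p: "p \<in> I" for p
  proof
    assume "lw p y = 0"
    then have "ennreal (c p) * \<psi> (lw p y) = \<infinity>" using c(1)[OF p] by (simp add: \<psi>_def ennreal_mult_eq_top_iff)
    moreover have "ennreal (c p) * \<psi> (lw p y) \<le> H y"
      unfolding H_def using I p by (intro add_increasing2) (auto intro!: member_le_sum)
    ultimately show False using y by (simp add: top_unique)
  qed
  have "H y = ennreal ((\<Sum>p\<in>I. c p * lw p y powr (- s)) + ?T y powr s + (\<Sum>q\<in>L. s * ?r * (lv q y / ?T y)))"
  proof -
    have 1: "(\<Sum>p\<in>I. ennreal (c p) * \<psi> (lw p y)) = ennreal (\<Sum>p\<in>I. c p * lw p y powr (- s))"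
      using c(1) nz by (subst sum_ennreal[symmetric]) (auto simp: \<psi>_def ennreal_mult less_imp_le intro!: sum.cong)
    have lv: "lv q y / ?T y \<ge> 0" for q unfolding lv_def by (simp add: sum_nonneg)
    have lv': "s * ?r * (lv q y / ?T y) \<ge> 0" for q using s r by (intro mult_nonneg_nonneg lv) auto
    have "(\<Sum>q\<in>L. ennreal (s * ?r) * ennreal (lv q y / ?T y)) = (\<Sum>q\<in>L. ennreal (s * ?r * (lv q y / ?T y)))"
      using s r by (intro sum.cong refl ennreal_mult[symmetric] lv) auto
    also have "\<dots> = ennreal (\<Sum>q\<in>L. s * ?r * (lv q y / ?T y))"
      by (intro sum_ennreal lv')
    finally have 2: "(\<Sum>q\<in>L. ennreal (s * ?r) * ennreal (lv q y / ?T y)) = ennreal (\<Sum>q\<in>L. s * ?r * (lv q y / ?T y))" .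
    have 3: "(\<Sum>p\<in>I. c p * lw p y powr (- s)) \<ge> 0" using c(1) by (intro sum_nonneg) (auto simp: less_imp_le)
    have 4: "(\<Sum>q\<in>L. s * ?r * (lv q y / ?T y)) \<ge> 0" by (intro sum_nonneg lv')
    show ?thesis unfolding H_def 1 2 using 3 4 by (simp add: ennreal_plus)
  qed
  with y have "(\<Sum>p\<in>I. c p * lw p y powr (- s)) + ?T y powr s + (\<Sum>q\<in>L. s * ?r * (lv q y / ?T y)) \<le> ?m + ?n + s + s\<^sup>2"
    using m n s by (simp add: ennreal_le_iff del: ennreal_plus)
  moreover have "(\<Sum>q\<in>L. s * ?r * (lv q y / ?T y)) = s * (?r * ((\<Sum>q\<in>L. lv q y) / ?T y))"
    by (simp add: sum_distrib_left sum_divide_distrib mult.assoc)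
  ultimately show thesis
    using nz by (intro that[of y]) (auto simp: lw_def lv_def)
qed

text \<open>Applying ln t <= t - 1 to q^(-s), to T^s and to r Q / T and combining with the moment
  bound gives the estimate, up to terms that vanish as s tends to 0. Positivity of Q is a premise
  inside the conclusion: the moment bound controls Q only from above, and the caller derives it from
  the nonvanishing of the forms.\<close>

lemma exists_log_bound:
  fixes W :: "'p \<Rightarrow> 'i \<Rightarrow> 'a" and V :: "'q \<Rightarrow> 'i \<Rightarrow> 'a" and \<alpha> :: real
  defines "\<alpha> \<equiv> DIM('a) / 2"
  assumes J: "finite J" "J \<noteq> {}" and e: "e > 0"
    and I: "finite I" and c: "\<And>p. p \<in> I \<Longrightarrow> c p > 0" "(\<Sum>p\<in>I. c p) = 1"
    and W: "\<And>p. p \<in> I \<Longrightarrow> (\<Sum>k\<in>J. (norm (W p k))\<^sup>2) = 1"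
    and L: "finite L" and V: "(\<Sum>q\<in>L. \<Sum>k\<in>J. (norm (V q k))\<^sup>2) = 1"
  obtains y where "\<And>p. p \<in> I \<Longrightarrow> (\<Sum>k\<in>J. W p k * y k) \<noteq> 0"
    and "(\<Sum>q\<in>L. (norm (\<Sum>k\<in>J. V q k * y k))\<^sup>2) > 0 \<Longrightarrow>
      (\<Sum>p\<in>I. c p * ln ((norm (\<Sum>k\<in>J. W p k * y k))\<^sup>2)) - ln (\<Sum>q\<in>L. (norm (\<Sum>k\<in>J. V q k * y k))\<^sup>2)
       \<ge> Digamma \<alpha> - Digamma (card J * \<alpha>) + ln (card J) - e"
proof -
  let ?T = "\<lambda>y. \<Sum>k\<in>J. (norm (y k :: 'a))\<^sup>2"
  let ?Q = "\<lambda>y. \<Sum>q\<in>L. (norm (\<Sum>k\<in>J. V q k * y k))\<^sup>2"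
  let ?q = "\<lambda>p y. (norm (\<Sum>k\<in>J. W p k * y k))\<^sup>2"
  let ?r = "real (card J)"
  \<comment> \<open>What the moment bound leaves after division by s; its limit at 0 is the
    difference of the two digamma values plus ln r.\<close>
  define g where "g s = - ((Gamma (\<alpha> + (-1) * s) / Gamma \<alpha> - 1) / s) - (Gamma (?r * \<alpha> + 1 * s) / Gamma (?r * \<alpha>) - 1) / s
      + ln ?r - s" for s
  have r: "?r > 0" using J by (simp add: card_gt_0_iff)
  have \<alpha>: "\<alpha> > 0" unfolding \<alpha>_def by simp
  have "(g \<longlongrightarrow> - (-1 * Digamma \<alpha>) - 1 * Digamma (?r * \<alpha>) + ln ?r - 0) (at_right 0)"
    unfolding g_def using \<alpha> r by (intro tendsto_intros tendsto_Gamma_quotient) auto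
  then have "\<forall>\<^sub>F s in at_right 0. g s > Digamma \<alpha> - Digamma (?r * \<alpha>) + ln ?r - e"
    using e by (intro order_tendstoD(1)) auto
  moreover have "\<forall>\<^sub>F s in at_right 0. 0 < s \<and> s < \<alpha>"
    using \<alpha> by (auto simp: eventually_at_right)
  ultimately have "\<forall>\<^sub>F s in at_right 0. g s > Digamma \<alpha> - Digamma (?r * \<alpha>) + ln ?r - e \<and> 0 < s \<and> s < \<alpha>"
    by eventually_elim auto
  then obtain s where gs: "g s > Digamma \<alpha> - Digamma (?r * \<alpha>) + ln ?r - e" and s: "0 < s" "s < \<alpha>"
    using eventually_happens[of _ "at_right (0::real)"] by auto
  obtain y where nz: "\<And>p. p \<in> I \<Longrightarrow> (\<Sum>k\<in>J. W p k * y k) \<noteq> 0"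
    and y: "(\<Sum>p\<in>I. c p * ?q p y powr (- s)) + ?T y powr s + s * (?r * (?Q y / ?T y))
      \<le> Gamma (\<alpha> - s) / Gamma \<alpha> + Gamma (?r * \<alpha> + s) / Gamma (?r * \<alpha>) + s + s\<^sup>2"
    using exists_moment_bound[where W=W and V=V and c=c, OF J s[unfolded \<alpha>_def] I c W L V] unfolding \<alpha>_def by blast
  have bound: "(\<Sum>p\<in>I. c p * ln (?q p y)) - ln (?Q y) \<ge> g s" if Q: "?Q y > 0"
  proof -
    have "?T y \<noteq> 0"
    proof
      assume "?T y = 0"
      then have "y k = 0" if "k \<in> J" for k using that J by (simp add: sum_nonneg_eq_0_iff)
      then have "?Q y = 0" by simp
      with Q show False by simp
    qed
    then have T: "?T y > 0" by (simp add: less_le sum_nonneg)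
    have q: "?q p y > 0" if "p \<in> I" for p using nz[OF that] by simp
    have 1: "s * ln (?q p y) \<ge> 1 - ?q p y powr (- s)" if "p \<in> I" for p
      using ln_le_minus_one[of "?q p y powr (- s)"] q[OF that] by (simp add: ln_powr)
    have "(\<Sum>p\<in>I. c p * (1 - ?q p y powr (- s))) \<le> (\<Sum>p\<in>I. c p * (s * ln (?q p y)))"
      by (intro sum_mono mult_left_mono 1) (auto simp: c less_imp_le)
    then have A: "s * (\<Sum>p\<in>I. c p * ln (?q p y)) \<ge> 1 - (\<Sum>p\<in>I. c p * ?q p y powr (- s))"
      by (simp add: algebra_simps sum_subtractf c(2) sum_distrib_left)
    have B: "s * ln (?T y) \<le> ?T y powr s - 1"
      using ln_le_minus_one[of "?T y powr s"] T by (simp add: ln_powr)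
    have "ln (?r * (?Q y / ?T y)) \<le> ?r * (?Q y / ?T y) - 1"
      using r Q T by (intro ln_le_minus_one) auto
    then have C: "ln ?r + ln (?Q y) - ln (?T y) \<le> ?r * (?Q y / ?T y) - 1"
      using r Q T by (simp add: ln_mult ln_div)
    have D: "s * (ln ?r + ln (?Q y) - ln (?T y)) \<le> s * (?r * (?Q y / ?T y) - 1)"
      using s by (intro mult_left_mono C) auto
    have "s * ((\<Sum>p\<in>I. c p * ln (?q p y)) - ln (?Q y)) \<ge> 
      1 - Gamma (\<alpha> - s) / Gamma \<alpha> - (Gamma (?r * \<alpha> + s) / Gamma (?r * \<alpha>) - 1) + s * ln ?r - s\<^sup>2"
      using A B D y by (simp only: right_diff_distrib distrib_left mult_1_right)
    also have "1 - Gamma (\<alpha> - s) / Gamma \<alpha> - (Gamma (?r * \<alpha> + s) / Gamma (?r * \<alpha>) - 1) + s * ln ?r - s\<^sup>2 = s * g s"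
      unfolding g_def using s by (simp add: field_simps power2_eq_square)
    finally show ?thesis using s by simp
  qed
  show thesis
  proof (rule that[of y])
    show "(\<Sum>k\<in>J. W p k * y k) \<noteq> 0" if "p \<in> I" for p using that by (rule nz)
    show "Digamma \<alpha> - Digamma (?r * \<alpha>) + ln ?r - e \<le> (\<Sum>p\<in>I. c p * ln (?q p y)) - ln (?Q y)"
      if "?Q y > 0"
      using gs bound[OF that] by linarith
  qed
qed

end

section \<open>Positive semidefinite matrices\<close>

context conj_field
begin

lemma inner_of_real_1 [simp]: "(of_real t :: 'a) \<bullet> 1 = t"
  by (simp add: of_real_def power2_norm_eq_inner[symmetric] dot_square_norm)

text \<open>A fixed point of conjugation satisfies h^2 = |h|^2, so h is plus or minus |h|.
  Throughout, the inner product with 1 serves as the real part in either field.\<close>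

lemma cj_fixed_eq_of_real:
  assumes "cj h = h" shows "h = of_real (h \<bullet> 1)"
proof -
  have "(h - of_real (norm h)) * (h + of_real (norm h)) = 0"
    using mult_cj[of h] assms by (simp add: algebra_simps power2_eq_square)
  then have "h = of_real (norm h) \<or> h = of_real (- norm h)"
    by (auto simp: eq_neg_iff_add_eq_0)
  then show ?thesis by (metis inner_of_real_1)
qed

definition quad_form :: "'a^'n^'n \<Rightarrow> 'a^'n \<Rightarrow> 'a" where
  "quad_form A x = (\<Sum>a\<in>UNIV. cj (x $ a) * (\<Sum>b\<in>UNIV. A $ a $ b * x $ b))"

definition hermitian :: "'a^'n^'n \<Rightarrow> bool" where
  "hermitian A \<longleftrightarrow> (\<forall>a b. cj (A $ b $ a) = A $ a $ b)"

definition psd :: "'a^'n^'n \<Rightarrow> bool" where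
  "psd A \<longleftrightarrow> hermitian A \<and> (\<forall>x. quad_form A x \<bullet> 1 \<ge> 0)"

definition trace_prod :: "'a^'n^'n \<Rightarrow> 'a^'n^'n \<Rightarrow> 'a" where
  "trace_prod A X = (\<Sum>a\<in>UNIV. \<Sum>b\<in>UNIV. cj (A $ b $ a) * X $ b $ a)"

text \<open>The product of the matrix with columns \<open>u k\<close> and its conjugate transpose;
  not the matrix of the pairwise inner products.\<close>

definition gram :: "(nat \<Rightarrow> 'a^'n) \<Rightarrow> nat \<Rightarrow> 'a^'n^'n" where
  "gram u r = (\<chi> a b. \<Sum>k<r. u k $ a * cj (u k $ b))"

lemma cj_mult_self: "cj x * x = of_real ((norm x)\<^sup>2)"
  by (simp only: mult_cj mult.commute)

lemma quad_form_gram: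
  "quad_form (gram v R) x = of_real (\<Sum>j<R. (norm (\<Sum>b\<in>UNIV. cj (v j $ b) * x $ b))\<^sup>2)"
proof -
  have "quad_form (gram v R) x = 
    (\<Sum>a\<in>UNIV. \<Sum>b\<in>UNIV. \<Sum>j<R. (v j $ a * cj (x $ a)) * (cj (v j $ b) * x $ b))"
    by (simp add: quad_form_def gram_def sum_distrib_left sum_distrib_right mult_ac)
  also have "\<dots> = (\<Sum>a\<in>UNIV. \<Sum>j<R. \<Sum>b\<in>UNIV. (v j $ a * cj (x $ a)) * (cj (v j $ b) * x $ b))"
    by (intro sum.cong refl sum.swap)
  also have "\<dots> = (\<Sum>j<R. \<Sum>a\<in>UNIV. \<Sum>b\<in>UNIV. (v j $ a * cj (x $ a)) * (cj (v j $ b) * x $ b))"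
    by (rule sum.swap)
  also have "\<dots> = (\<Sum>j<R. cj (\<Sum>b\<in>UNIV. cj (v j $ b) * x $ b) * (\<Sum>b\<in>UNIV. cj (v j $ b) * x $ b))"
    by (simp add: cj_sum cj_mult cj_cj sum_product)
  finally show ?thesis by (simp only: cj_mult_self of_real_sum)
qed

lemma sum_swap3:
  "(\<Sum>b\<in>B. \<Sum>j\<in>J. \<Sum>k\<in>K. f b j k) = (\<Sum>j\<in>J. \<Sum>k\<in>K. \<Sum>b\<in>B. f b j k)"
  by (rule trans[OF sum.swap]) (intro sum.cong refl sum.swap)

lemma trace_prod_gram:
  "trace_prod (gram v R) (gram u r) = 
    of_real (\<Sum>j<R. \<Sum>k<r. (norm (\<Sum>a\<in>UNIV. cj (v j $ a) * u k $ a))\<^sup>2)"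
proof -
  let ?f = "\<lambda>a b j k. (cj (v j $ b) * u k $ b) * (v j $ a * cj (u k $ a))"
  have "trace_prod (gram v R) (gram u r) = 
    (\<Sum>a\<in>UNIV. \<Sum>b\<in>UNIV. \<Sum>j<R. \<Sum>k<r. ?f a b j k)"
    by (simp add: trace_prod_def gram_def cj_sum cj_mult cj_cj sum_product) (simp add: mult_ac)
  also have "\<dots> = (\<Sum>a\<in>UNIV. \<Sum>j<R. \<Sum>k<r. \<Sum>b\<in>UNIV. ?f a b j k)"
    by (intro sum.cong refl sum_swap3)
  also have "\<dots> = (\<Sum>j<R. \<Sum>k<r. \<Sum>a\<in>UNIV. \<Sum>b\<in>UNIV. ?f a b j k)"
    by (rule sum_swap3)
  also have "\<dots> = (\<Sum>j<R. \<Sum>k<r. (\<Sum>a\<in>UNIV. cj (v j $ a) * u k $ a) * cj (\<Sum>a\<in>UNIV. cj (v j $ a) * u k $ a))"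
    by (simp add: cj_sum cj_mult cj_cj sum_distrib_left[symmetric] sum_distrib_right[symmetric])
  finally show ?thesis by (simp only: mult_cj of_real_sum)
qed

lemma psd_diag:
  assumes "psd A"
  shows "A $ i $ i = of_real (A $ i $ i \<bullet> 1)" "A $ i $ i \<bullet> 1 \<ge> 0"
proof -
  show "A $ i $ i = of_real (A $ i $ i \<bullet> 1)"
    using assms by (intro cj_fixed_eq_of_real) (simp add: psd_def hermitian_def)
  have "quad_form A (axis i 1) = A $ i $ i"
    by (simp add: quad_form_def axis_def if_distrib if_distribR sum.delta cong: if_cong)
  then show "A $ i $ i \<bullet> 1 \<ge> 0" using assms unfolding psd_def by metis
qed

text \<open>Expansion along a single axis. It serves to kill off-diagonal entries next to a zero
  diagonal and to complete the square in the Cholesky step.\<close>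

lemma quad_form_add_axis:
  assumes "hermitian A"
  shows "quad_form A (x + t *s axis i 1) = quad_form A x + cj t * (\<Sum>b\<in>UNIV. A $ i $ b * x $ b)
    + t * cj (\<Sum>b\<in>UNIV. A $ i $ b * x $ b) + t * cj t * A $ i $ i"
proof -
  let ?e = "\<lambda>a. if a = i then (1::'a) else 0"
  have e: "(x + t *s axis i 1) $ a = x $ a + t * ?e a" for a
    by (simp add: axis_def)
  have A: "(\<Sum>b\<in>UNIV. A $ a $ b * (x $ b + t * ?e b)) = (\<Sum>b\<in>UNIV. A $ a $ b * x $ b) + t * A $ a $ i" for a
  proof -
    have "(\<Sum>b\<in>UNIV. A $ a $ b * (x $ b + t * ?e b)) = 
      (\<Sum>b\<in>UNIV. A $ a $ b * x $ b) + (\<Sum>b\<in>UNIV. if b = i then t * A $ a $ b else 0)"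
      unfolding sum.distrib[symmetric] by (intro sum.cong) (auto simp: distrib_left)
    then show ?thesis by simp
  qed
  have B: "cj (x $ a + t * ?e a) = cj (x $ a) + cj t * ?e a" for a
    by (simp add: cj_add cj_mult)
  have C: "cj (\<Sum>b\<in>UNIV. A $ i $ b * x $ b) = (\<Sum>a\<in>UNIV. cj (x $ a) * A $ a $ i)"
    using assms by (simp add: cj_sum cj_mult hermitian_def mult.commute)
  have "quad_form A (x + t *s axis i 1) = 
    (\<Sum>a\<in>UNIV. (cj (x $ a) + cj t * ?e a) * ((\<Sum>b\<in>UNIV. A $ a $ b * x $ b) + t * A $ a $ i))"
    unfolding quad_form_def e A B ..
  also have "\<dots> = quad_form A x + t * (\<Sum>a\<in>UNIV. cj (x $ a) * A $ a $ i)
     + (\<Sum>a\<in>UNIV. cj t * ?e a * ((\<Sum>b\<in>UNIV. A $ a $ b * x $ b) + t * A $ a $ i))"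
    unfolding quad_form_def distrib_right by (simp add: distrib_left sum.distrib sum_distrib_left mult_ac)
  also have "(\<Sum>a\<in>UNIV. cj t * ?e a * ((\<Sum>b\<in>UNIV. A $ a $ b * x $ b) + t * A $ a $ i)) = 
     cj t * ((\<Sum>b\<in>UNIV. A $ i $ b * x $ b) + t * A $ i $ i)"
    by (simp add: if_distrib if_distribR sum.delta cong: if_cong)
  finally show ?thesis unfolding C by (simp add: algebra_simps)
qed

text \<open>Testing the form on e_j + t e_i with t = - A_ij gives -2 |A_ij|^2, which must be
  nonnegative.\<close>

lemma psd_zero_diag:
  fixes A :: "'a^'n^'n"
  assumes "psd A" "A $ i $ i = 0" "A $ j $ j = 0"
  shows "A $ i $ j = 0"
proof -
  have h: "hermitian A" using assms by (simp add: psd_def)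
  define t where "t = - A $ i $ j"
  have q: "quad_form A (axis j 1) = A $ j $ j"
    by (simp add: quad_form_def axis_def if_distrib if_distribR sum.delta cong: if_cong)
  have s: "(\<Sum>b\<in>UNIV. A $ i $ b * (axis j 1 :: 'a^'n) $ b) = A $ i $ j"
    by (simp add: axis_def if_distrib if_distribR sum.delta cong: if_cong)
  have "quad_form A (axis j 1 + t *s axis i 1) = cj t * A $ i $ j + t * cj (A $ i $ j)"
    unfolding quad_form_add_axis[OF h] q s assms by simp
  also have "\<dots> = - (2 * (A $ i $ j * cj (A $ i $ j)))"
    by (simp add: t_def cj_minus)
  also have "\<dots> = of_real (- 2 * (norm (A $ i $ j))\<^sup>2)"
    by (simp add: mult_cj)
  finally have "quad_form A (axis j 1 + t *s axis i 1) \<bullet> 1 = - 2 * (norm (A $ i $ j))\<^sup>2"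
    by (simp only: inner_of_real_1)
  moreover have "quad_form A (axis j 1 + t *s axis i 1) \<bullet> 1 \<ge> 0" using assms by (simp add: psd_def)
  ultimately show ?thesis by simp
qed

text \<open>One step of the Cholesky decomposition.\<close>
lemma psd_deflate:
  fixes A :: "'a^'n^'n"
  assumes A: "psd A" and i: "A $ i $ i \<noteq> 0"
  defines "B \<equiv> (\<chi> a b. A $ a $ b - A $ a $ i * A $ i $ b / A $ i $ i)"
  shows "psd B" "rank B < rank A"
proof -
  have h: "hermitian A" using A by (simp add: psd_def)
  then have hA: "cj (A $ b $ a) = A $ a $ b" for a b by (simp add: hermitian_def)
  define p where "p = A $ i $ i \<bullet> 1"
  have Aii: "A $ i $ i = of_real p" and p: "p > 0"
    using psd_diag[OF A, of i] i unfolding p_def by (auto simp: less_le)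
  have hB: "hermitian B"
    unfolding hermitian_def B_def
    by (simp add: cj_diff hA divide_inverse cj_mult) (simp add: Aii flip: of_real_inverse)
  have "quad_form B x \<bullet> 1 \<ge> 0" for x
  proof -
    define g where "g = (\<Sum>b\<in>UNIV. A $ i $ b * x $ b)"
    have cg: "cj g = (\<Sum>a\<in>UNIV. cj (x $ a) * A $ a $ i)"
      unfolding g_def by (simp add: cj_sum cj_mult hA mult.commute)
    \<comment> \<open>The minimiser of the form of \<open>A\<close> over x + t e_i. The minimum is
      the form of the Schur complement \<open>B\<close> at x, whence its nonnegativity.\<close>
    define t where "t = - g / of_real p"
    have ct: "cj t = - cj g / of_real p"
      unfolding t_def by (simp add: divide_inverse cj_mult cj_minus flip: of_real_inverse)
    have "quad_form B x = (\<Sum>a\<in>UNIV. cj (x $ a) * ((\<Sum>b\<in>UNIV. A $ a $ b * x $ b) - A $ a $ i / of_real p * g))"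
      unfolding quad_form_def B_def g_def Aii
      by (simp add: left_diff_distrib sum_subtractf sum_distrib_left sum_divide_distrib mult.assoc)
    also have "\<dots> = quad_form A x - cj g * g / of_real p"
      unfolding cg quad_form_def
      by (simp add: right_diff_distrib sum_subtractf sum_distrib_right sum_divide_distrib mult.assoc)
    also have "\<dots> = quad_form A (x + t *s axis i 1)"
      unfolding quad_form_add_axis[OF h] g_def[symmetric] ct Aii
      using p by (simp add: t_def field_simps)
    finally show ?thesis using A by (simp add: psd_def)
  qed
  with hB show "psd B" by (simp add: psd_def)
  have Bi: "B $ a $ i = 0" for a unfolding B_def using i by simp
  have sub: "vec.span (rows B) \<subseteq> vec.span (rows A)"
  proof (rule vec.span_minimal)
    show "rows B \<subseteq> vec.span (rows A)"
    proof
      fix z assume "z \<in> rows B"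
      then obtain a where z: "z = row a B" unfolding rows_def by auto
      have "row a B = row a A - (A $ a $ i / A $ i $ i) *s row i A"
        by (simp add: vec_eq_iff row_def B_def)
      moreover have "row a A - (A $ a $ i / A $ i $ i) *s row i A \<in> vec.span (rows A)"
        by (intro vec.span_diff vec.span_scale vec.span_base) (auto simp: rows_def)
      ultimately show "z \<in> vec.span (rows A)" by (simp add: z)
    qed
  qed simp
  \<comment> \<open>The rank really drops: column i of \<open>B\<close> is zero, so the row space of
    \<open>B\<close> lies in the hyperplane z_i = 0, which misses row i of \<open>A\<close>.\<close>
  have "row i A \<in> vec.span (rows A)" by (auto simp: rows_def intro!: vec.span_base)
  moreover have "row i A \<notin> vec.span (rows B)"
  proof
    assume "row i A \<in> vec.span (rows B)"
    moreover have "vec.span (rows B) \<subseteq> {z. z $ i = 0}"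
      by (rule vec.span_minimal) (auto simp: rows_def row_def Bi vec.subspace_def)
    ultimately show False using i by (auto simp: row_def)
  qed
  ultimately have "vec.span (rows B) \<subset> vec.span (rows A)" using sub by blast
  then show "rank B < rank A" unfolding row_rank_def_gen by (rule vec.dim_psubset)
qed

text \<open>Each step splits off column i divided by the square root of the pivot and lowers the
  rank. Once the diagonal is zero the matrix is zero, and zero vectors fill the remaining
  places.\<close>

lemma psd_eq_gram:
  fixes A :: "'a^'n^'n"
  assumes "psd A" "rank A \<le> r"
  obtains u where "A = gram u r"
proof -
  have "\<exists>u. A = gram u r" using assms
  proof (induction r arbitrary: A)
    case 0
    \<comment> \<open>A nonzero pivot would allow a deflation to rank below 0.\<close>
    have diag: "A $ i $ i = 0" for i
      using psd_deflate(2)[OF 0(1), of i] 0(2) by auto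
    then have "A = gram (\<lambda>_. 0) 0"
      using psd_zero_diag[OF 0(1)] by (simp add: vec_eq_iff gram_def)
    then show ?case by blast
  next
    case (Suc r)
    have h: "cj (A $ b $ a) = A $ a $ b" for a b using Suc.prems by (simp add: psd_def hermitian_def)
    show ?case
    proof (cases "\<exists>i. A $ i $ i \<noteq> 0")
      case False
      then have "A = gram (\<lambda>_. 0) (Suc r)"
        using psd_zero_diag[OF Suc.prems(1)] by (simp add: vec_eq_iff gram_def)
      then show ?thesis by blast
    next
      case True
      then obtain i where i: "A $ i $ i \<noteq> 0" by blast
      define p where "p = A $ i $ i \<bullet> 1"
      have Aii: "A $ i $ i = of_real p" and p: "p > 0"
        using psd_diag[OF Suc.prems(1), of i] i unfolding p_def by (auto simp: less_le)
      let ?B = "\<chi> a b. A $ a $ b - A $ a $ i * A $ i $ b / A $ i $ i"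
      have "psd ?B" "rank ?B \<le> r"
        using psd_deflate[OF Suc.prems(1) i] Suc.prems(2) by simp_all
      from Suc.IH[OF this] obtain u where u: "?B = gram u r" by blast
      define v where "v = (\<chi> a. A $ a $ i / of_real (sqrt p))"
      have "A = gram (u(r := v)) (Suc r)"
      proof -
        have "A $ a $ b = gram (u(r := v)) (Suc r) $ a $ b" for a b
        proof -
          have "A $ a $ b = ?B $ a $ b + A $ a $ i * A $ i $ b / A $ i $ i" by simp
          also have "?B $ a $ b = (\<Sum>k<r. (u(r := v)) k $ a * cj ((u(r := v)) k $ b))"
            unfolding u by (simp add: gram_def)
          also have "A $ a $ i * A $ i $ b / A $ i $ i = v $ a * cj (v $ b)"
          proof -
            have "(inverse (of_real p) :: 'a) = inverse (of_real (sqrt p)) * inverse (of_real (sqrt p))"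
              unfolding inverse_mult_distrib[symmetric] of_real_mult[symmetric] using p by simp
            then show ?thesis
              unfolding v_def Aii by (simp add: divide_inverse cj_mult h flip: of_real_inverse)
          qed
          finally show ?thesis by (simp add: gram_def)
        qed
        then show ?thesis by (simp add: vec_eq_iff)
      qed
      then show ?thesis by blast
    qed
  qed
  then show thesis using that by blast
qed

end

section \<open>Rounding\<close>

context conj_field
begin

lemma gram_linear_combination:
  fixes u :: "nat \<Rightarrow> 'a^'n" and c :: "'a^'n"
  shows "(\<Sum>b\<in>UNIV. cj (c $ b) * (\<Sum>k<r. u k $ b * y k)) = (\<Sum>k<r. (\<Sum>b\<in>UNIV. cj (c $ b) * u k $ b) * y k)"
proof -
  have "(\<Sum>b\<in>UNIV. cj (c $ b) * (\<Sum>k<r. u k $ b * y k)) = (\<Sum>b\<in>UNIV. \<Sum>k<r. cj (c $ b) * u k $ b * y k)"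
    by (simp add: sum_distrib_left mult.assoc)
  also have "\<dots> = (\<Sum>k<r. \<Sum>b\<in>UNIV. cj (c $ b) * u k $ b * y k)" by (rule sum.swap)
  finally show ?thesis by (simp add: sum_distrib_right)
qed

lemma quad_form_scale: "quad_form A (of_real t *s x) = of_real (t\<^sup>2) * quad_form A x"
  by (simp add: quad_form_def cj_mult sum_distrib_left power2_eq_square mult_ac)

lemma inner_of_real_mult_1: "((of_real t * z) :: 'a) \<bullet> 1 = t * (z \<bullet> 1)"
  by (simp add: scaleR_conv_of_real[symmetric])

lemma psd_imp_gram: "psd A \<Longrightarrow> \<exists>u. A = gram u (rank A)"
  using psd_eq_gram[of A "rank A"] by auto

lemma trace_prod_nonneg:
  assumes "psd A" "psd X" shows "trace_prod A X \<bullet> 1 \<ge> 0"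
proof -
  obtain v R u r where A: "A = gram v R" and X: "X = gram u r"
    using psd_imp_gram assms by blast
  show ?thesis unfolding A X trace_prod_gram inner_of_real_1 by (simp add: sum_nonneg)
qed

text \<open>The common form of both constants: Digamma (1/2) = - gamma - 2 ln 2 gives
  \<open>L_R\<close>, and Digamma 1 = - gamma gives \<open>L_C\<close>.\<close>

definition digamma_gap :: "nat \<Rightarrow> real" where
  "digamma_gap r = Digamma (r * (DIM('a) / 2)) - ln r - Digamma (DIM('a) / 2)"

lemma ln_sum_ge:
  assumes "finite S" "\<And>j. j \<in> S \<Longrightarrow> c j \<ge> 0" "(\<Sum>j\<in>S. c j) = 1" "\<And>j. j \<in> S \<Longrightarrow> x j > 0"
  shows "(\<Sum>j\<in>S. c j * ln (x j)) \<le> ln (\<Sum>j\<in>S. c j * x j :: real)"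
proof -
  have "S \<noteq> {}" using assms(3) by auto
  from concave_on_sum[OF assms(1) this ln_concave assms(3,2)] assms(4) show ?thesis by simp
qed

text \<open>All pairs (i, j) of a form and a Gram vector of it go into one application of the log
  bound, so a single vector serves every form. Concavity of ln is then used within each form
  separately.\<close>

lemma exists_rounding:
  fixes A :: "nat \<Rightarrow> 'a^'n^'n"
  assumes A: "\<And>i. i < d \<Longrightarrow> psd (A i)" and X: "psd X" and tr: "(\<Sum>a\<in>UNIV. X $ a $ a) = 1"
    and d: "d > 0" and pos: "\<And>i. i < d \<Longrightarrow> trace_prod (A i) X \<bullet> 1 > 0" and e: "e > 0"
  obtains x where "(\<Sum>a\<in>UNIV. (norm (x $ a))\<^sup>2) = 1" "\<And>i. i < d \<Longrightarrow> quad_form (A i) x \<bullet> 1 > 0"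
    "(\<Sum>i<d. ln (quad_form (A i) x \<bullet> 1)) \<ge> (\<Sum>i<d. ln (trace_prod (A i) X \<bullet> 1)) - d * (digamma_gap (rank X) + e)"
proof -
  define r where "r = rank X"
  obtain u where u: "X = gram u r" using psd_imp_gram[OF X] r_def by blast
  have "\<forall>i. \<exists>v. i < d \<longrightarrow> A i = gram v (rank (A i))" using psd_imp_gram[OF A] by blast
  then obtain v where v': "\<And>i. i < d \<Longrightarrow> A i = gram (v i) (rank (A i))" by metis
  define R where "R i = rank (A i)" for i
  have v: "A i = gram (v i) (R i)" if "i < d" for i using v'[OF that] by (simp only: R_def)
  \<comment> \<open>Coefficients of y in the inner product of \<open>v i j\<close> with the trial
    vector x.\<close>
  define w where "w i j k = (\<Sum>a\<in>UNIV. cj (v i j $ a) * u k $ a)" for i j k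
  define N where "N i j = (\<Sum>k<r. (norm (w i j k))\<^sup>2)" for i j
  define t where "t i = trace_prod (A i) X \<bullet> 1" for i
  have N0: "N i j \<ge> 0" for i j unfolding N_def by (simp add: sum_nonneg)
  have t: "t i = (\<Sum>j<R i. N i j)" if "i < d" for i
  proof -
    have "trace_prod (A i) X = of_real (\<Sum>j<R i. N i j)"
      unfolding N_def w_def v[OF that] u by (rule trace_prod_gram)
    then show ?thesis unfolding t_def by (simp only: inner_of_real_1)
  qed
  have tpos: "t i > 0" if "i < d" for i using pos[OF that] by (simp add: t_def)
  have "(of_real (\<Sum>q\<in>UNIV. \<Sum>k<r. (norm (u k $ q))\<^sup>2) :: 'a) = 1"
    using tr unfolding u by (simp add: gram_def mult_cj)
  \<comment> \<open>Trace one is exactly the normalisation that the log bound asks of its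
    denominator; it also rules out r = 0.\<close>
  then have V: "(\<Sum>q\<in>UNIV. \<Sum>k<r. (norm (u k $ q))\<^sup>2) = 1"
    by (simp only: of_real_eq_1_iff)
  then have J: "{..<r} \<noteq> {}" by auto
  \<comment> \<open>Terms with N = 0 are dropped because the unit vectors \<open>W\<close> arise by
    division by sqrt N and the weights must be positive. Their omission leaves \<open>t i\<close>
    unchanged and can only lower the estimate of \<open>f i\<close>.\<close>
  define S where "S i = {j\<in>{..<R i}. N i j > 0}" for i
  define I where "I = Sigma {..<d} S"
  have fS: "finite (S i)" for i unfolding S_def by simp
  have fI: "finite I" unfolding I_def using fS by simp
  have tS: "(\<Sum>j\<in>S i. N i j) = t i" if "i < d" for i
    unfolding t[OF that] S_def using N0 by (intro sum.mono_neutral_left) (auto simp: less_le)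
  \<comment> \<open>Within each form the weights N / t sum to 1; the factor 1/d makes the total over
    all forms 1 and matches the geometric mean.\<close>
  define c where "c p = N (fst p) (snd p) / t (fst p) / d" for p
  have c: "c p > 0" if "p \<in> I" for p
    using that tpos d unfolding c_def I_def S_def by auto
  have c1: "(\<Sum>p\<in>I. c p) = 1"
  proof -
    have "(\<Sum>p\<in>I. c p) = (\<Sum>i<d. \<Sum>j\<in>S i. N i j / t i / d)"
      unfolding I_def c_def by (subst sum.Sigma) (auto simp: fS case_prod_beta)
    also have "\<dots> = (\<Sum>i<d. 1 / real d)"
      using tS tpos by (intro sum.cong) (auto simp: sum_divide_distrib[symmetric] less_imp_neq[symmetric])
    finally show ?thesis using d by simp
  qed
  define W where "W p k = w (fst p) (snd p) k / of_real (sqrt (N (fst p) (snd p)))" for p k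
  have W: "(\<Sum>k<r. (norm (W p k))\<^sup>2) = 1" if "p \<in> I" for p
  proof -
    have "N (fst p) (snd p) > 0" using that unfolding I_def S_def by auto
    then show ?thesis
      unfolding W_def by (simp add: norm_divide power_divide sum_divide_distrib[symmetric] N_def[symmetric])
  qed
  obtain y where nz: "\<And>p. p \<in> I \<Longrightarrow> (\<Sum>k<r. W p k * y k) \<noteq> 0"
    and y: "(\<Sum>q\<in>UNIV. (norm (\<Sum>k<r. u k $ q * y k))\<^sup>2) > 0 \<Longrightarrow>
      (\<Sum>p\<in>I. c p * ln ((norm (\<Sum>k<r. W p k * y k))\<^sup>2)) - ln (\<Sum>q\<in>UNIV. (norm (\<Sum>k<r. u k $ q * y k))\<^sup>2)
       \<ge> Digamma (DIM('a) / 2) - Digamma (card {..<r} * (DIM('a) / 2)) + ln (card {..<r}) - e"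
    using exists_log_bound[where J="{..<r}" and W=W and V="\<lambda>q k. u k $ q" and L=UNIV and I=I and c=c and e=e,
        OF finite_lessThan J e fI c c1 W finite V] by blast
  define x where "x = (\<chi> b. \<Sum>k<r. u k $ b * y k)"
  define Q where "Q = (\<Sum>a\<in>UNIV. (norm (x $ a))\<^sup>2)"
  define f where "f i = quad_form (A i) x \<bullet> 1" for i
  have f: "f i = (\<Sum>j<R i. (norm (\<Sum>k<r. w i j k * y k))\<^sup>2)" if "i < d" for i
  proof -
    have "quad_form (A i) x = of_real (\<Sum>j<R i. (norm (\<Sum>k<r. w i j k * y k))\<^sup>2)"
      using quad_form_gram[of "v i" "R i" x] v[OF that]
      unfolding x_def w_def by (simp only: gram_linear_combination vec_lambda_beta)
    then show ?thesis unfolding f_def by (simp only: inner_of_real_1)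
  qed
  let ?q = "\<lambda>i j. (norm (\<Sum>k<r. W (i, j) k * y k))\<^sup>2"
  have wW: "(norm (\<Sum>k<r. w i j k * y k))\<^sup>2 = N i j * ?q i j" if "j \<in> S i" for i j
  proof -
    have n: "N i j > 0" using that unfolding S_def by simp
    have "(\<Sum>k<r. W (i, j) k * y k) = (\<Sum>k<r. w i j k * y k) / of_real (sqrt (N i j))"
      unfolding W_def by (simp add: sum_divide_distrib)
    then show ?thesis using n by (simp add: norm_divide power_divide)
  qed
  have fge: "f i \<ge> (\<Sum>j\<in>S i. N i j * ?q i j)" if "i < d" for i
  proof -
    have "(\<Sum>j\<in>S i. N i j * ?q i j) = (\<Sum>j\<in>S i. (norm (\<Sum>k<r. w i j k * y k))\<^sup>2)"
      by (simp add: wW)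
    also have "\<dots> \<le> f i" unfolding f[OF that] by (intro sum_mono2) (auto simp: S_def)
    finally show ?thesis .
  qed
  have qpos: "?q i j > 0" if "i < d" "j \<in> S i" for i j
    using nz[of "(i, j)"] that by (simp add: I_def)
  have lnf: "ln (f i) \<ge> ln (t i) + (\<Sum>j\<in>S i. N i j / t i * ln (?q i j)) \<and> f i > 0" if i: "i < d" for i
  proof -
    have n1: "(\<Sum>j\<in>S i. N i j / t i) = 1"
      using tS[OF i] tpos[OF i] by (simp add: sum_divide_distrib[symmetric])
    have le: "(\<Sum>j\<in>S i. N i j / t i * ln (?q i j)) \<le> ln (\<Sum>j\<in>S i. N i j / t i * ?q i j)"
      using N0 tpos[OF i] n1 qpos[OF i] by (intro ln_sum_ge fS) auto
    have ne: "S i \<noteq> {}" using n1 by auto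
    have p: "(\<Sum>j\<in>S i. N i j / t i * ?q i j) > 0"
      using tpos[OF i] qpos[OF i] by (intro sum_pos fS ne mult_pos_pos divide_pos_pos) (auto simp: S_def)
    have "t i * (\<Sum>j\<in>S i. N i j / t i * ?q i j) = (\<Sum>j\<in>S i. N i j * ?q i j)"
      using tpos[OF i] by (simp add: sum_distrib_left)
    then have ge: "t i * (\<Sum>j\<in>S i. N i j / t i * ?q i j) \<le> f i" using fge[OF i] by simp
    have p2: "t i * (\<Sum>j\<in>S i. N i j / t i * ?q i j) > 0" using p tpos[OF i] by simp
    have "ln (t i) + ln (\<Sum>j\<in>S i. N i j / t i * ?q i j) = ln (t i * (\<Sum>j\<in>S i. N i j / t i * ?q i j))"
      using p tpos[OF i] by (simp add: ln_mult)
    also have "\<dots> \<le> ln (f i)" using ge p2 by simp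
    finally show ?thesis using le ge p2 by linarith
  qed
  \<comment> \<open>The premise left open by the log bound: x = 0 would make the form with index 0,
    available since d > 0, vanish.\<close>
  have Q: "Q > 0"
  proof (rule ccontr)
    assume "\<not> ?thesis"
    then have "Q = 0" unfolding Q_def by (simp add: sum_nonneg order.antisym not_less)
    then have "x $ a = 0" for a unfolding Q_def by (simp add: sum_nonneg_eq_0_iff)
    then have "f 0 = 0" unfolding f_def quad_form_def by simp
    then show False using lnf[OF d] by simp
  qed
  have yQ: "(\<Sum>p\<in>I. c p * ln ((norm (\<Sum>k<r. W p k * y k))\<^sup>2)) - ln Q \<ge> - digamma_gap r - e"
    using y Q unfolding digamma_gap_def Q_def x_def by simp
  have sumI: "real d * (\<Sum>p\<in>I. c p * ln ((norm (\<Sum>k<r. W p k * y k))\<^sup>2)) = (\<Sum>i<d. \<Sum>j\<in>S i. N i j / t i * ln (?q i j))"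
  proof -
    have "(\<Sum>p\<in>I. c p * ln ((norm (\<Sum>k<r. W p k * y k))\<^sup>2)) = (\<Sum>i<d. \<Sum>j\<in>S i. c (i, j) * ln (?q i j))"
      unfolding I_def by (subst sum.Sigma) (auto simp: fS)
    then show ?thesis using d by (simp add: sum_distrib_left c_def)
  qed
  have "(\<Sum>i<d. ln (t i)) + (\<Sum>i<d. \<Sum>j\<in>S i. N i j / t i * ln (?q i j)) \<le> (\<Sum>i<d. ln (f i))"
    unfolding sum.distrib[symmetric] using lnf by (intro sum_mono) auto
  then have lnf_sum: "(\<Sum>i<d. ln (t i)) + real d * (ln Q - digamma_gap r - e) \<le> (\<Sum>i<d. ln (f i))"
    unfolding sumI[symmetric] using yQ d
    by (smt (verit, best) mult_left_mono of_nat_0_le_iff)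
  define z where "z = of_real (1 / sqrt Q) *s x"
  have qz: "quad_form (A i) z \<bullet> 1 = f i / Q" for i
    unfolding z_def quad_form_scale inner_of_real_mult_1 f_def using Q by (simp add: power_divide)
  show thesis
  proof (rule that[of z])
    show "(\<Sum>a\<in>UNIV. (norm (z $ a))\<^sup>2) = 1"
      using Q by (simp add: z_def norm_mult norm_divide power_mult_distrib power_divide sum_divide_distrib[symmetric] Q_def[symmetric])
    show "quad_form (A i) z \<bullet> 1 > 0" if "i < d" for i
      using lnf[OF that] Q by (simp add: qz)
    have "ln (quad_form (A i) z \<bullet> 1) = ln (f i) - ln Q" if "i < d" for i
      using conjunct2[OF lnf[OF that]] Q by (simp add: qz ln_div)
    then have "(\<Sum>i<d. ln (quad_form (A i) z \<bullet> 1)) = (\<Sum>i<d. ln (f i) - ln Q)"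
      by (intro sum.cong) auto
    also have "\<dots> = (\<Sum>i<d. ln (f i)) - d * ln Q" by (simp add: sum_subtractf)
    finally show "(\<Sum>i<d. ln (quad_form (A i) z \<bullet> 1)) \<ge> (\<Sum>i<d. ln (trace_prod (A i) X \<bullet> 1)) - d * (digamma_gap (rank X) + e)"
      using lnf_sum unfolding t_def r_def by (simp add: algebra_simps)
  qed
qed

section \<open>Rank-one matrices and the two inequalities\<close>

definition rank_one :: "'a^'n \<Rightarrow> 'a^'n^'n" where
  "rank_one x = (\<chi> a b. x $ a * cj (x $ b))"

lemma rank_one_eq_gram: "rank_one x = gram (\<lambda>_. x) 1"
  by (simp add: rank_one_def gram_def vec_eq_iff)

lemma psd_gram: "psd (gram u r)"
proof -
  have "hermitian (gram u r)"
    by (simp add: hermitian_def gram_def cj_sum cj_mult cj_cj mult.commute)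
  moreover have "quad_form (gram u r) x \<bullet> 1 \<ge> 0" for x
    unfolding quad_form_gram inner_of_real_1 by (simp add: sum_nonneg)
  ultimately show ?thesis by (simp add: psd_def)
qed

lemma trace_rank_one: "(\<Sum>a\<in>UNIV. rank_one x $ a $ a) = of_real (\<Sum>a\<in>UNIV. (norm (x $ a))\<^sup>2)"
  by (simp add: rank_one_def mult_cj)

lemma trace_prod_rank_one:
  assumes "hermitian A"
  shows "trace_prod A (rank_one x) = quad_form A x"
proof -
  have "trace_prod A (rank_one x) = (\<Sum>a\<in>UNIV. \<Sum>b\<in>UNIV. cj (x $ a) * (A $ a $ b * x $ b))"
    using assms by (simp add: trace_prod_def rank_one_def hermitian_def mult_ac)
  then show ?thesis by (simp add: quad_form_def sum_distrib_left)
qed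

lemma exp_sum_ln:
  assumes "d > 0" "\<And>i. i < d \<Longrightarrow> f i > (0::real)"
  shows "root d (\<Prod>i<d. f i) = exp ((\<Sum>i<d. ln (f i)) / d)"
proof -
  have "(\<Prod>i<d. f i) = exp (\<Sum>i<d. ln (f i))"
    using assms by (simp add: exp_sum)
  also have "\<dots> = exp ((\<Sum>i<d. ln (f i)) / d) ^ d"
    using assms by (simp add: exp_of_nat_mult[symmetric])
  finally show ?thesis using assms by (simp add: real_root_power_cancel)
qed

text \<open>The upper bound holds because a unit vector x gives a feasible rank-one matrix with the
  same objective. The lower bound is the rounding with e tending to 0, except when the optimal value
  is 0 and nonnegativity suffices.\<close>

lemma rounding_bounds:
  fixes A :: "nat \<Rightarrow> 'a^'n^'n" and d :: nat
  defines "opt \<equiv> Sup {root d (\<Prod>i<d. quad_form (A i) x \<bullet> 1) | x. (\<Sum>a\<in>UNIV. (norm (x $ a))\<^sup>2) = 1}"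
    and "obj \<equiv> \<lambda>Y. root d (\<Prod>i<d. trace_prod (A i) Y \<bullet> 1)"
    and "feasible \<equiv> \<lambda>Y :: 'a^'n^'n. psd Y \<and> (\<Sum>a\<in>UNIV. Y $ a $ a) = 1"
  assumes A: "\<And>i. i < d \<Longrightarrow> psd (A i)" and X: "feasible X"
    and opt: "\<And>Y. feasible Y \<Longrightarrow> obj Y \<le> obj X"
  shows "exp (- digamma_gap (rank X)) * Sup {obj Y | Y. feasible Y} \<le> opt" "opt \<le> Sup {obj Y | Y. feasible Y}"
proof -
  let ?S = "{root d (\<Prod>i<d. quad_form (A i) x \<bullet> 1) | x. (\<Sum>a\<in>UNIV. (norm (x $ a))\<^sup>2) = 1}"
  have Sup: "Sup {obj Y | Y. feasible Y} = obj X"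
    using X opt by (intro cSup_eq_maximum) auto
  have le: "root d (\<Prod>i<d. quad_form (A i) x \<bullet> 1) \<le> obj X" if x: "(\<Sum>a\<in>UNIV. (norm (x $ a))\<^sup>2) = 1" for x
  proof -
    have "feasible (rank_one x)"
      unfolding feasible_def trace_rank_one x by (simp add: rank_one_eq_gram psd_gram)
    moreover have "obj (rank_one x) = root d (\<Prod>i<d. quad_form (A i) x \<bullet> 1)"
      unfolding obj_def using A by (intro arg_cong[where f="root d"] prod.cong) (auto simp: trace_prod_rank_one psd_def)
    ultimately show ?thesis using opt by metis
  qed
  then have bdd: "bdd_above ?S" by (auto intro!: bdd_aboveI)
  have upper: "s \<le> opt" if "s \<in> ?S" for s
    unfolding opt_def using that bdd by (rule cSup_upper)
  have "(\<Sum>a\<in>UNIV. (norm ((axis i 1 :: 'a^'n) $ a))\<^sup>2) = 1" for i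
  proof -
    have "(norm ((axis i 1 :: 'a^'n) $ a))\<^sup>2 = (if a = i then 1 else 0)" for a by (simp add: axis_def)
    then show ?thesis by simp
  qed
  then have ex: "root d (\<Prod>i<d. quad_form (A i) (axis undefined 1) \<bullet> 1) \<in> ?S" by blast
  then have ne: "?S \<noteq> {}" by blast
  show "opt \<le> Sup {obj Y | Y. feasible Y}"
    unfolding Sup unfolding opt_def using ne le by (intro cSup_least) auto
  have opt0: "0 \<le> opt"
    using A by (intro order_trans[OF _ upper[OF ex]] real_root_ge_zero prod_nonneg) (auto simp: psd_def)
  have tp: "trace_prod (A i) X \<bullet> 1 \<ge> 0" if "i < d" for i
    using A[OF that] X unfolding feasible_def by (auto intro: trace_prod_nonneg)
  show "exp (- digamma_gap (rank X)) * Sup {obj Y | Y. feasible Y} \<le> opt"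
  proof (cases "d > 0 \<and> (\<forall>i<d. trace_prod (A i) X \<bullet> 1 \<noteq> 0)")
    case False
    \<comment> \<open>For d = 0 because \<open>root 0\<close> is constantly 0, otherwise because one
      factor vanishes.\<close>
    then have "obj X = 0" unfolding obj_def by (cases "d = 0") auto
    then show ?thesis unfolding Sup using opt0 by simp
  next
    case True
    then have pos: "trace_prod (A i) X \<bullet> 1 > 0" if "i < d" for i
      using tp[OF that] that unfolding less_le by auto
    have bound: "exp (- digamma_gap (rank X) - e) * obj X \<le> opt" if e: "e > 0" for e
    proof -
      obtain x where x: "(\<Sum>a\<in>UNIV. (norm (x $ a))\<^sup>2) = 1" "\<And>i. i < d \<Longrightarrow> quad_form (A i) x \<bullet> 1 > 0"
        and ln: "(\<Sum>i<d. ln (quad_form (A i) x \<bullet> 1)) \<ge> (\<Sum>i<d. ln (trace_prod (A i) X \<bullet> 1)) - d * (digamma_gap (rank X) + e)"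
      proof (rule exists_rounding[of d A X e])
        show "psd X" "(\<Sum>a\<in>UNIV. X $ a $ a) = 1" using X unfolding feasible_def by auto
        show "d > 0" using True by simp
      qed (use A pos e in auto)
      have "exp (- digamma_gap (rank X) - e) * obj X = exp (((\<Sum>i<d. ln (trace_prod (A i) X \<bullet> 1)) - d * (digamma_gap (rank X) + e)) / d)"
        unfolding obj_def using True pos
        by (subst exp_sum_ln) (auto simp: exp_add[symmetric] field_simps)
      also have "\<dots> \<le> root d (\<Prod>i<d. quad_form (A i) x \<bullet> 1)"
        using True x(2) ln by (subst exp_sum_ln) (auto intro: divide_right_mono)
      also have "\<dots> \<le> opt" using x(1) by (intro upper) blast
      finally show ?thesis .
    qed
    have "((\<lambda>e. exp (- digamma_gap (rank X) - e) * obj X) \<longlongrightarrow> exp (- digamma_gap (rank X) - 0) * obj X) (at_right 0)"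
      by (intro tendsto_intros)
    moreover have "\<forall>\<^sub>F e in at_right 0. exp (- digamma_gap (rank X) - e) * obj X \<le> opt"
      using bound by (auto intro: eventually_at_right_less[THEN eventually_mono])
    ultimately have "exp (- digamma_gap (rank X) - 0) * obj X \<le> opt"
      by (rule tendsto_upperbound) simp
    then show ?thesis unfolding Sup by simp
  qed
qed

end

section \<open>The real and the complex case\<close>

text \<open>Positive rank permits splitting ln (r / 2) into ln r - ln 2 when the gap is identified
  with \<open>L_R\<close>.\<close>

lemma (in conj_field) rank_pos_of_trace:
  assumes "psd X" "(\<Sum>a\<in>UNIV. X $ a $ a) \<noteq> 0"
  shows "rank X > 0"
proof (rule ccontr)
  assume "\<not> ?thesis"
  with assms(1) obtain u where "X = gram u 0" using psd_imp_gram[OF assms(1)] by auto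
  then show False using assms(2) by (simp add: gram_def)
qed

text \<open>The increment of ln Gamma from x to x + 1 is ln x by the functional equation, and equals
  Digamma z for some z > x by the mean value theorem; Digamma is increasing.\<close>

lemma Digamma_less_ln:
  assumes x: "(x::real) > 0"
  shows "Digamma x < ln x"
proof -
  have "\<exists>z. z > x \<and> z < x + 1 \<and> ln_Gamma (x + 1) - ln_Gamma x = (x + 1 - x) * Digamma z"
    using x by (intro MVT2) (auto intro!: derivative_eq_intros)
  then obtain z where z: "z > x" "ln_Gamma (x + 1) - ln_Gamma x = Digamma z" by auto
  have "Gamma (x + 1) = x * Gamma x" by (rule Gamma_plus1[OF pos_not_nonpos_Ints[OF x]])
  then have "ln_Gamma (x + 1) - ln_Gamma x = ln x"
    using x pos_not_nonpos_Ints[OF x] by (simp add: ln_Gamma_real_pos ln_mult Gamma_eq_zero_iff)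
  then show ?thesis using z Digamma_real_strict_mono[OF x z(1)] by simp
qed

lemma ln_2_lower: "ln 2 > (0.6931 :: real)"
  using ln_approx_bounds[of 2 5] by (simp add: lessThan_Suc numeral_eq_Suc field_simps)

text \<open>The harmonic sum stops at 63 so that the logarithm to subtract is ln 64 = 6 ln 2. In
  both estimates ln 2 then has a negative coefficient, -6 and -5, and a lower bound for it
  suffices.\<close>

lemma euler_mascheroni_ln_2_bounds: 
  "euler_mascheroni < (0.578 :: real)" "euler_mascheroni + ln 2 < (1.271 :: real)"
proof -
  have l64: "ln 64 = 6 * ln (2::real)" using ln_realpow[of 2 6] by simp
  have "euler_mascheroni \<le> harm 63 - 6 * ln 2 + (1 / 126 :: real)"
    using euler_mascheroni_upper[of 62] l64 by simp
  moreover have "harm 63 < (4.7283 :: real)" by (simp add: harm_expand)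
  ultimately show "euler_mascheroni < (0.578 :: real)" "euler_mascheroni + ln 2 < (1.271 :: real)"
    using ln_2_lower by simp_all
qed

section \<open>Instantiation to real and complex scalars\<close>

interpretation real: conj_field "\<lambda>x::real. x"
  by standard (auto simp: power2_eq_square)

declare real.cj_0 [simp del] real.cj_1 [simp del] real.cj_of_real [simp del] real.norm_cj [simp del]

interpretation complex: conj_field cnj
  by standard (simp_all only: complex_cnj_add complex_cnj_mult complex_cnj_cnj complex_norm_square)

lemma real_quad_form: "real.quad_form A x = x \<bullet> (A *v x)"
  by (simp add: real.quad_form_def inner_vec_def matrix_vector_mult_def)

lemma real_psd: "real.psd A \<longleftrightarrow> psd_R A"
  by (auto simp: real.psd_def psd_R_def real.hermitian_def real_quad_form vec_eq_iff transpose_def)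

lemma real_trace_prod: "real.trace_prod A X = trace (transpose A ** X)"
  by (simp add: real.trace_prod_def trace_def matrix_matrix_mult_def transpose_def)

lemma real_norm_one: "(\<Sum>a\<in>UNIV. (norm (x $ a))\<^sup>2) = 1 \<longleftrightarrow> x \<bullet> x = 1" for x :: "real^'n"
  by (simp add: inner_vec_def power2_eq_square)

lemma real_feasible: "psd_R X \<and> (\<Sum>a\<in>UNIV. X $ a $ a) = 1 \<longleftrightarrow> sdp_feasible_R X"
  by (simp add: sdp_feasible_R_def trace_def)

lemma real_digamma_gap: "r > 0 \<Longrightarrow> real.digamma_gap r = L_R r"
  by (simp add: real.digamma_gap_def L_R_def Digamma_one_half ln_div)

lemma complex_inner_1: "z \<bullet> 1 = Re z"
  by (simp add: inner_complex_def)

lemma complex_quad_form: "complex.quad_form A x = cinner x (A *v x)"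
  by (simp add: complex.quad_form_def cinner_def matrix_vector_mult_def)

lemma complex_psd: "complex.psd A \<longleftrightarrow> psd_C A"
  by (auto simp: complex.psd_def psd_C_def complex.hermitian_def complex_quad_form complex_inner_1
      vec_eq_iff adjoint_mat_def)

lemma complex_trace_prod: "complex.trace_prod A X = trace (adjoint_mat A ** X)"
  by (simp add: complex.trace_prod_def trace_def matrix_matrix_mult_def adjoint_mat_def)

lemma complex_norm_one: "(\<Sum>a\<in>UNIV. (norm (x $ a))\<^sup>2) = 1 \<longleftrightarrow> cinner x x = 1" for x :: "complex^'n"
proof -
  have "cinner x x = of_real (\<Sum>a\<in>UNIV. (norm (x $ a))\<^sup>2)"
    unfolding cinner_def of_real_sum by (intro sum.cong refl) (rule complex.cj_mult_self)
  then show ?thesis by (simp only: of_real_eq_1_iff)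
qed

lemma complex_feasible: "psd_C X \<and> (\<Sum>a\<in>UNIV. X $ a $ a) = 1 \<longleftrightarrow> sdp_feasible_C X"
  by (simp add: sdp_feasible_C_def trace_def)

lemma complex_digamma_gap: "complex.digamma_gap r = L_C r"
  by (simp add: complex.digamma_gap_def L_C_def)

lemma bounds_R:
  assumes "\<And>i. i < d \<Longrightarrow> psd_R (A i)" "sdp_optimal_R A d X"
  shows "exp (- L_R (rank X)) * OptSDP_R A d \<le> Opt_R A d" "Opt_R A d \<le> OptSDP_R A d"
proof -
  have X: "sdp_feasible_R X" using assms by (simp add: sdp_optimal_R_def)
  have "rank X > 0"
    using X unfolding real_feasible[symmetric] real_psd[symmetric] by (intro real.rank_pos_of_trace) auto
  then have L: "real.digamma_gap (rank X) = L_R (rank X)" by (rule real_digamma_gap)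
  show "exp (- L_R (rank X)) * OptSDP_R A d \<le> Opt_R A d" "Opt_R A d \<le> OptSDP_R A d"
    using real.rounding_bounds[of d A X, unfolded real_feasible real_psd real_quad_form real_trace_prod
        real_norm_one L] assms X
    by (simp_all add: sdp_optimal_R_def sdp_obj_R_def OptSDP_R_def Opt_R_def)
qed

lemma bounds_C:
  assumes "\<And>i. i < d \<Longrightarrow> psd_C (A i)" "sdp_optimal_C A d X"
  shows "exp (- L_C (rank X)) * OptSDP_C A d \<le> Opt_C A d" "Opt_C A d \<le> OptSDP_C A d"
  using complex.rounding_bounds[of d A X, unfolded complex_feasible complex_psd complex_quad_form
      complex_trace_prod complex_norm_one complex_inner_1 complex_digamma_gap] assms
  by (simp_all add: sdp_optimal_C_def sdp_obj_C_def OptSDP_C_def Opt_C_def)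

lemma L_R_less: "r > 0 \<Longrightarrow> L_R r < 1.271"
  using Digamma_less_ln[of "r / 2"] euler_mascheroni_ln_2_bounds(2) by (simp add: L_R_def)

lemma L_C_less: "r > 0 \<Longrightarrow> L_C r < 0.578"
  using Digamma_less_ln[of r] euler_mascheroni_ln_2_bounds(1) by (simp add: L_C_def)

theorem theorem1:
  shows "(\<forall>(A :: nat \<Rightarrow> real^'n^'n) (d :: nat) (X :: real^'n^'n) (r :: nat).
            (\<forall>i<d. psd_R (A i)) \<and> sdp_optimal_R A d X \<and> rank X = r \<longrightarrow>
              exp (- L_R r) * OptSDP_R A d \<le> Opt_R A d \<and> Opt_R A d \<le> OptSDP_R A d)
       \<and> (\<forall>(A :: nat \<Rightarrow> complex^'n^'n) (d :: nat) (X :: complex^'n^'n) (r :: nat).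
            (\<forall>i<d. psd_C (A i)) \<and> sdp_optimal_C A d X \<and> rank X = r \<longrightarrow>
              exp (- L_C r) * OptSDP_C A d \<le> Opt_C A d \<and> Opt_C A d \<le> OptSDP_C A d)
       \<and> (\<forall>r :: nat. r > 0 \<longrightarrow> L_R r < 1.271 \<and> L_C r < 0.578)"
proof (intro conjI allI impI, goal_cases)
  case (1 A d X r)
  then show ?case using bounds_R(1)[of d A X] by auto
next
  case (2 A d X r)
  then show ?case using bounds_R(2)[of d A X] by auto
next
  case (3 A d X r)
  then show ?case using bounds_C(1)[of d A X] by auto
next
  case (4 A d X r)
  then show ?case using bounds_C(2)[of d A X] by auto
next
  case (5 r)
  then show ?case by (rule L_R_less)
next
  case (6 r)
  then show ?case by (rule L_C_less)
qed

end
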